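(* Let $\mathcal{M}$ be a constrained Markov decision process, $s\in\mathcal{S}$ an initial state, $\Delta\in\mathbb{N}$, and let $\tilde{\mathcal{M}}$ be the augmented MDP. The set of stationary policies of $\tilde{\mathcal{M}}$ is adequate for the problem $$\max_{\tilde\pi\in\tilde\Pi_H}\ \mathbb{E}_{\tilde\pi}\Big[\sum_{t=0}^\infty R_{t+1}\,\Big|\,(S_0,K_0)=(s,\Delta)\Big]\quad\text{s.t.}\quad P_{\tilde\pi}\big(\tilde D_{t+1}=0\mid (S_0,K_0)=(s,\Delta)\big)=1\ \ \forall t\ge 0 .$$ That is, for every history-dependent policy $\tilde\pi_h\in\tilde\Pi_H$ feasible for this problem there is a stationary policy $\tilde\pi$ of $\tilde{\mathcal{M}}$ that is feasible for this problem and satisfies $$\mathbb{E}_{\tilde\pi}\Big[\sum_{t=0}^\infty R_{t+1}\,\Big|\,(S_0,K_0)=(s,\Delta)\Big]=\mathbb{E}_{\tilde\pi_h}\Big[\sum_{t=0}^\infty R_{t+1}\,\Big|\,(S_0,K_0)=(s,\Delta)\Big].$$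
   Context: A constrained Markov decision process (CMDP) $\mathcal{M}=(\mathcal{S},\mathcal{A},p,r,d)$ has a finite state set $\mathcal{S}$, a finite action set $\mathcal{A}$, and a transition kernel $p(s',r,d\mid s,a)$ giving the joint conditional law of the next state $S_{t+1}=s'$, the reward $R_{t+1}=r\in\mathbb{R}$ and the binary damage indicator $D_{t+1}=d\in\{0,1\}$ given $S_t=s,A_t=a$. Standing assumptions: rewards have finite conditional expectation given $(s,a)$; there is an absorbing termination state in which the system remains with no further reward; and this state is eventually reached (with probability one) under any policy, including history-dependent ones, from any initial state. The budget is $K_0=\Delta$ and $K_{t+1}=K_t-D_{t+1}$ (integer valued; it may become negative once more than $\Delta$ units of damage have occurred). The augmented MDP $\tilde{\mathcal{M}}$ has transition tuples $(\tilde S_t,A_t,\tilde S_{t+1},R_{t+1},\tilde D_{t+1})$ obtained from those of $\mathcal{M}$ by $\tilde S_t=(S_t,K_t)$ and $\tilde D_{t+1}=\mathbf{1}\{K_t-D_{t+1}<0\}$. $\tilde\Pi_H$ is the set of history-dependent randomized policies of $\tilde{\mathcal{M}}$, which choose $A_t$ according to a distribution $\tilde\pi(\cdot\mid\tilde h_t)$ on $\mathcal{A}$, where $\tilde h_t=(\tilde s_0,a_0,r_1,\tilde d_1,\tilde s_1,\dots,a_{t-1},r_t,\tilde d_t,\tilde s_t)$. A stationary policy of $\tilde{\mathcal{M}}$ chooses $A_t$ according to a distribution $\tilde\pi(\cdot\mid S_t,K_t)$ depending only on the current augmented state (randomization allowed). A policy is feasible if it satisfies the constraint. *)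

theory Defs
  imports "HOL-Probability.Probability"
begin

text \<open>
  A Markov decision process is given by a kernel \<open>p\<close>, where \<open>p x a\<close> is the joint law of
  (next state, reward, damage indicator) given state \<open>x\<close> and action \<open>a\<close>. State spaces are
  countable types carrying the discrete sigma-algebra; rewards are arbitrary real random variables.
  The same notions serve the original process (finite state type \<open>'s\<close>) and the augmented one
  (state type \<open>'s \<times> int\<close>).
\<close>

type_synonym 'x outcome = "'x \<times> real \<times> bool"
type_synonym ('x, 'a) kernel = "'x \<Rightarrow> 'a \<Rightarrow> 'x outcome measure"

definition outcome_space :: "'x outcome measure" where
  "outcome_space = count_space UNIV \<Otimes>\<^sub>M (borel \<Otimes>\<^sub>M count_space UNIV)"

locale mdp =
  fixes p :: "('x::countable, 'a::finite) kernel"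
  assumes kernel: "p x a \<in> space (prob_algebra outcome_space)"


subsection \<open>Histories and policies\<close>

text \<open>
  The transition made at time \<open>t\<close> is recorded as \<open>(A\<^sub>t, S\<^sub>t\<^sub>+\<^sub>1, R\<^sub>t\<^sub>+\<^sub>1, D\<^sub>t\<^sub>+\<^sub>1)\<close>. A history of length
  \<open>t\<close> is the initial state together with the transitions made at times \<open>0, \<dots>, t - 1\<close>.
\<close>

type_synonym ('x, 'a) transition = "'a \<times> 'x outcome"
type_synonym ('x, 'a) history = "'x \<times> (nat \<Rightarrow> ('x, 'a) transition)"
type_synonym ('x, 'a) policy = "nat \<Rightarrow> ('x, 'a) history \<Rightarrow> 'a pmf"

definition next_state :: "('x, 'a) transition \<Rightarrow> 'x" where
  "next_state z = fst (snd z)"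

definition reward :: "('x, 'a) transition \<Rightarrow> real" where
  "reward z = fst (snd (snd z))"

definition damage :: "('x, 'a) transition \<Rightarrow> bool" where
  "damage z = snd (snd (snd z))"

definition transition_space :: "('x, 'a) transition measure" where
  "transition_space = count_space UNIV \<Otimes>\<^sub>M outcome_space"

definition history_space :: "nat \<Rightarrow> ('x, 'a) history measure" where
  "history_space t = count_space UNIV \<Otimes>\<^sub>M (\<Pi>\<^sub>M i\<in>{0..<t}. transition_space)"

fun state_at :: "nat \<Rightarrow> ('x, 'a) history \<Rightarrow> 'x" where
  "state_at 0 (x, \<omega>) = x"
| "state_at (Suc t) (x, \<omega>) = next_state (\<omega> t)"

definition history_policies :: "('x, 'a) policy set" where
  "history_policies =
     {\<pi>. \<forall>t. (\<lambda>h. measure_pmf (\<pi> t h)) \<in> history_space t \<rightarrow>\<^sub>M prob_algebra (count_space UNIV)}"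

definition stationary_policies :: "('x, 'a) policy set" where
  "stationary_policies = {\<pi>. \<exists>\<phi> :: 'x \<Rightarrow> 'a pmf. \<pi> = (\<lambda>t h. \<phi> (state_at t h))}"


subsection \<open>The law of the process\<close>

definition transition_law ::
    "('x, 'a) kernel \<Rightarrow> ('x, 'a) policy \<Rightarrow> nat \<Rightarrow> ('x, 'a) history \<Rightarrow> ('x, 'a) transition measure" where
  "transition_law p \<pi> t h =
     measure_pmf (\<pi> t h) \<bind> (\<lambda>a. distr (p (state_at t h) a) transition_space (Pair a))"

text \<open>
  The law of the infinite sequence of transitions from the initial state \<open>x\<close>, i.e.\ the
  Ionescu-Tulcea projective limit of the laws above (constant \<open>PF.lim\<close> of the locale
  \<open>Ionescu_Tulcea\<close>); conditioning on the initial state means using this measure.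
\<close>

definition trajectory ::
    "('x, 'a) kernel \<Rightarrow> ('x, 'a) policy \<Rightarrow> 'x \<Rightarrow> (nat \<Rightarrow> ('x, 'a) transition) measure" where
  "trajectory p \<pi> x =
     projective_family.lim UNIV
       (Ionescu_Tulcea.CI (\<lambda>t \<omega>. transition_law p \<pi> t (x, \<omega>)) (\<lambda>_. transition_space))
       (\<lambda>_. transition_space)"

definition expected_return :: "('x, 'a) kernel \<Rightarrow> 'x \<Rightarrow> ('x, 'a) policy \<Rightarrow> real" where
  "expected_return p x \<pi> = (\<integral>\<omega>. (\<Sum>t. reward (\<omega> t)) \<partial>trajectory p \<pi> x)"

definition feasible :: "('x, 'a) kernel \<Rightarrow> 'x \<Rightarrow> ('x, 'a) policy \<Rightarrow> bool" where
  "feasible p x \<pi> \<longleftrightarrow> (\<forall>t. \<P>(\<omega> in trajectory p \<pi> x. \<not> damage (\<omega> t)) = 1)"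


subsection \<open>Constrained processes and augmentation by the budget\<close>

locale cmdp = mdp p
  for p :: "('s::finite, 'a::finite) kernel" +
  fixes s_end :: 's
  assumes integrable_reward: "integrable (p s a) (\<lambda>(s', r, d). r)"
    and absorbing: "AE (s', r, d) in p s_end a. s' = s_end \<and> r = 0"
    and terminating: "\<pi> \<in> history_policies \<Longrightarrow>
      AE \<omega> in trajectory p \<pi> s. \<exists>t. state_at t (s, \<omega>) = s_end"

definition augment :: "('s, 'a) kernel \<Rightarrow> ('s \<times> int, 'a) kernel" where
  "augment p = (\<lambda>(s, k) a.
     distr (p s a) outcome_space (\<lambda>(s', r, d). ((s', k - of_bool d), r, k - of_bool d < 0)))"


subsection \<open>Well-definedness\<close>

lemma space_outcome_space [simp]: "space outcome_space = UNIV"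
  by (simp add: outcome_space_def space_pair_measure)

lemma space_transition_space [simp]: "space transition_space = UNIV"
  by (simp add: transition_space_def space_pair_measure)

lemma measurable_next_state [measurable]: "next_state \<in> transition_space \<rightarrow>\<^sub>M count_space UNIV"
  unfolding next_state_def transition_space_def outcome_space_def by measurable

lemma measurable_reward [measurable]: "reward \<in> borel_measurable transition_space"
  unfolding reward_def transition_space_def outcome_space_def by measurable

lemma measurable_damage [measurable]: "damage \<in> transition_space \<rightarrow>\<^sub>M count_space UNIV"
  unfolding damage_def transition_space_def outcome_space_def by measurable

lemma measurable_state_at [measurable]:
  "(state_at t :: ('x, 'a) history \<Rightarrow> 'x) \<in> history_space t \<rightarrow>\<^sub>M count_space UNIV"
proof (cases t)
  case 0
  then have "state_at t = (fst :: ('x, 'a) history \<Rightarrow> 'x)" by (auto simp: fun_eq_iff)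
  then show ?thesis by (simp add: history_space_def)
next
  case (Suc n)
  then have *: "state_at t = (\<lambda>h :: ('x, 'a) history. next_state (snd h n))" by (auto simp: fun_eq_iff)
  have "(\<lambda>h :: ('x, 'a) history. snd h n) \<in> history_space t \<rightarrow>\<^sub>M transition_space"
    unfolding history_space_def
    by (rule measurable_compose[OF measurable_snd measurable_component_singleton]) (simp add: Suc)
  then show ?thesis
    unfolding * by (rule measurable_compose[OF _ measurable_next_state])
qed

lemma stationary_policies_subset:
  "(stationary_policies :: ('x::countable, 'a) policy set) \<subseteq> history_policies"
proof
  fix \<pi> :: "('x, 'a) policy" assume "\<pi> \<in> stationary_policies"
  then obtain \<phi> where \<pi>: "\<pi> = (\<lambda>t h. \<phi> (state_at t h))" by (auto simp: stationary_policies_def)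
  have "(\<lambda>x. measure_pmf (\<phi> x)) \<in> count_space UNIV \<rightarrow>\<^sub>M prob_algebra (count_space UNIV)"
    by (auto simp: space_prob_algebra prob_space_measure_pmf)
  then show "\<pi> \<in> history_policies"
    by (auto simp: history_policies_def \<pi> intro: measurable_compose[OF measurable_state_at])
qed

context mdp
begin

lemma measurable_transition_law:
  assumes "\<pi> \<in> history_policies"
  shows "transition_law p \<pi> t \<in> history_space t \<rightarrow>\<^sub>M prob_algebra transition_space"
  unfolding transition_law_def
proof (rule measurable_bind_prob_space2)
  show "(\<lambda>h. measure_pmf (\<pi> t h)) \<in> history_space t \<rightarrow>\<^sub>M prob_algebra (count_space UNIV)"
    using assms by (simp add: history_policies_def)
next
  have "(\<lambda>(x, a). distr (p x a) transition_space (Pair a)) \<in>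
          count_space UNIV \<Otimes>\<^sub>M count_space UNIV \<rightarrow>\<^sub>M prob_algebra transition_space"
  proof (subst pair_measure_countable)
    have "Pair a \<in> p x a \<rightarrow>\<^sub>M transition_space" for x and a :: 'a
      using kernel[of x a] unfolding transition_space_def
      by (auto simp: space_prob_algebra cong: measurable_cong_sets)
    then show "(\<lambda>(x, a). distr (p x a) transition_space (Pair a)) \<in>
        count_space (UNIV \<times> UNIV) \<rightarrow>\<^sub>M prob_algebra transition_space"
      using kernel by (auto simp: space_prob_algebra intro!: prob_space.prob_space_distr)
  qed auto
  note K = this
  have "(\<lambda>z. (state_at t (fst z), snd z)) \<in> history_space t \<Otimes>\<^sub>M count_space (UNIV :: 'a set) \<rightarrow>\<^sub>M
      count_space (UNIV :: 'x set) \<Otimes>\<^sub>M count_space UNIV"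
    by (intro measurable_Pair measurable_snd measurable_compose[OF measurable_fst measurable_state_at])
  from measurable_compose[OF this K]
  show "(\<lambda>(h, a). distr (p (state_at t h) a) transition_space (Pair a)) \<in>
      history_space t \<Otimes>\<^sub>M count_space UNIV \<rightarrow>\<^sub>M prob_algebra transition_space"
    by (simp add: split_beta')
qed

lemma Ionescu_Tulcea_transition_law:
  assumes "\<pi> \<in> history_policies"
  shows "Ionescu_Tulcea (\<lambda>t \<omega>. transition_law p \<pi> t (x, \<omega>)) (\<lambda>_. transition_space)"
proof -
  have K: "(\<lambda>\<omega>. transition_law p \<pi> t (x, \<omega>)) \<in>
      (\<Pi>\<^sub>M i\<in>{0..<t}. transition_space) \<rightarrow>\<^sub>M prob_algebra transition_space" for t
    using measurable_transition_law[OF assms, of t] unfolding history_space_def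
    by (rule measurable_compose[rotated]) simp
  show ?thesis
  proof (rule Ionescu_Tulcea.intro)
    show "(\<lambda>\<omega>. transition_law p \<pi> t (x, \<omega>)) \<in>
        (\<Pi>\<^sub>M i\<in>{0..<t}. transition_space) \<rightarrow>\<^sub>M subprob_algebra transition_space" for t
      by (rule measurable_prob_algebraD[OF K])
    fix t and \<omega> :: "nat \<Rightarrow> ('x, 'a) transition"
    assume "\<omega> \<in> space (\<Pi>\<^sub>M i\<in>{0..<t}. transition_space)"
    from measurable_space[OF K this] show "prob_space (transition_law p \<pi> t (x, \<omega>))"
      by (simp add: space_prob_algebra)
  qed
qed

lemma
  assumes "\<pi> \<in> history_policies"
  shows prob_space_trajectory: "prob_space (trajectory p \<pi> x)"
    and sets_trajectory: "sets (trajectory p \<pi> x) = sets (\<Pi>\<^sub>M i\<in>UNIV. transition_space)"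
    and distr_trajectory: "distr (trajectory p \<pi> x) (\<Pi>\<^sub>M i\<in>{0..<n}. transition_space) (\<lambda>\<omega>. restrict \<omega> {0..<n}) =
      Ionescu_Tulcea.CI (\<lambda>t \<omega>. transition_law p \<pi> t (x, \<omega>)) (\<lambda>_. transition_space) {0..<n}"
proof -
  interpret IT: Ionescu_Tulcea "\<lambda>t \<omega>. transition_law p \<pi> t (x, \<omega>)" "\<lambda>_. transition_space"
    by (rule Ionescu_Tulcea_transition_law[OF assms])
  show sets: "sets (trajectory p \<pi> x) = sets (\<Pi>\<^sub>M i\<in>UNIV. transition_space)"
    by (simp add: trajectory_def)
  show distr: "distr (trajectory p \<pi> x) (\<Pi>\<^sub>M i\<in>{0..<n}. transition_space) (\<lambda>\<omega>. restrict \<omega> {0..<n}) =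
      IT.CI {0..<n}" for n
    unfolding trajectory_def by (rule IT.distr_lim) simp
  have "(\<lambda>\<omega>. restrict \<omega> {0..<0}) \<in> trajectory p \<pi> x \<rightarrow>\<^sub>M (\<Pi>\<^sub>M i\<in>{0..<0::nat}. transition_space)"
    unfolding measurable_cong_sets[OF sets refl] by (rule measurable_restrict_subset) simp
  then show "prob_space (trajectory p \<pi> x)"
    by (rule prob_space_distrD) (simp only: distr IT.PF.prob_space_P finite_atLeastLessThan subset_UNIV)
qed

end

lemma mdp_augment:
  fixes p :: "('s::countable, 'a::finite) kernel"
  assumes "mdp p"
  shows "mdp (augment p)"
proof
  fix x :: "'s \<times> int" and a :: 'a
  obtain s k where x: "x = (s, k)" by (cases x)
  interpret mdp p by fact
  let ?O = "count_space (UNIV :: 's set) \<Otimes>\<^sub>M ((borel :: real measure) \<Otimes>\<^sub>M count_space (UNIV :: bool set))"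
  have D: "(\<lambda>z. snd (snd z)) \<in> ?O \<rightarrow>\<^sub>M count_space UNIV"
    by (intro measurable_compose[OF measurable_snd] measurable_snd)
  have R: "(\<lambda>z. fst (snd z)) \<in> ?O \<rightarrow>\<^sub>M borel"
    by (intro measurable_compose[OF measurable_snd] measurable_fst)
  have comp: "(\<lambda>z. g (snd (snd z))) \<in> ?O \<rightarrow>\<^sub>M count_space UNIV" for g :: "bool \<Rightarrow> 'c"
    by (rule measurable_compose[OF D]) simp
  have "(\<lambda>z. (fst z, k - of_bool (snd (snd z)))) \<in>
      ?O \<rightarrow>\<^sub>M count_space UNIV \<Otimes>\<^sub>M count_space (UNIV :: int set)"
    by (intro measurable_Pair measurable_fst comp)
  then have S: "(\<lambda>z. (fst z, k - of_bool (snd (snd z)))) \<in> ?O \<rightarrow>\<^sub>M count_space (UNIV :: ('s \<times> int) set)"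
    by (simp add: pair_measure_countable)
  have "(\<lambda>z. ((fst z, k - of_bool (snd (snd z))), fst (snd z), k - of_bool (snd (snd z)) < 0)) \<in>
      ?O \<rightarrow>\<^sub>M outcome_space"
    unfolding outcome_space_def by (intro measurable_Pair S R comp)
  moreover have "sets (p s a) = sets ?O"
    using kernel[of s a] by (simp add: space_prob_algebra outcome_space_def)
  ultimately have "(\<lambda>(s', r, d). ((s', k - of_bool d), r, k - of_bool d < 0)) \<in> p s a \<rightarrow>\<^sub>M outcome_space"
    by (simp add: case_prod_beta cong: measurable_cong_sets)
  then show "augment p x a \<in> space (prob_algebra outcome_space)"
    using kernel[of s a] by (auto simp: x augment_def space_prob_algebra intro!: prob_space.prob_space_distr)
qed

end

theory Submission
  imports Defs
begin

text \<open>
  The proof matches occupation measures. Every trap avoiding the termination state would be kept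
  by a stationary policy that never terminates, so from each state the termination state is reached
  with positive probability whatever the actions. This gives a bounded Lyapunov function whose
  expectation drops by at least one per step before termination, and hence every policy has a finite
  total occupation \<open>y(x, a)\<close> of nonterminal states. Given a feasible policy with occupation \<open>y\<close>, the
  stationary policy choosing \<open>a\<close> in \<open>x\<close> with probability \<open>y(x, a) / y(x)\<close> solves the same flow
  equation; solutions of finite mass are unique by the Lyapunov function, so the occupations agree,
  and with them the expected returns. Damage may still occur in the termination state, where \<open>y\<close> may be
  infinite; there the stationary policy plays some action that the given policy uses with positive
  probability. Thus it only visits state-action pairs visited by the given policy, and is feasible.
\<close>


subsection \<open>One-step formulas and occupation measures\<close>

lemma state_at_cong:
  assumes "\<And>i. i < t \<Longrightarrow> \<omega> i = \<omega>' i"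
  shows "state_at t (x, \<omega>) = state_at t (x, \<omega>')"
  using assms by (cases t) auto

lemma state_at_restrict [simp]: "state_at t (x, restrict \<omega> {0..<t}) = state_at t (x, \<omega>)"
  by (rule state_at_cong) simp

lemma measurable_state_at_PiM:
  assumes "{0..<t} \<subseteq> I"
  shows "(\<lambda>\<omega>. state_at t (x, \<omega>)) \<in> (\<Pi>\<^sub>M i\<in>I. transition_space) \<rightarrow>\<^sub>M count_space UNIV"
proof (cases t)
  case (Suc n)
  then have "(\<lambda>\<omega>. next_state (\<omega> n)) \<in> (\<Pi>\<^sub>M i\<in>I. transition_space) \<rightarrow>\<^sub>M count_space UNIV"
    using assms
    by (intro measurable_compose[OF _ measurable_next_state] measurable_component_singleton) auto
  then show ?thesis by (simp add: Suc)
qed simp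

text \<open>With a countable discrete parameter, measurability of each section already gives joint
  measurability.\<close>

lemma measurable_countable_param:
  fixes f :: "'x::countable \<Rightarrow> 'z \<Rightarrow> 'b"
  assumes "\<And>y. f y \<in> N \<rightarrow>\<^sub>M L" and "g \<in> M \<rightarrow>\<^sub>M count_space UNIV" and "h \<in> M \<rightarrow>\<^sub>M N"
  shows "(\<lambda>\<omega>. f (g \<omega>) (h \<omega>)) \<in> M \<rightarrow>\<^sub>M L"
  by (rule measurable_compose_countable'[where I=UNIV, OF measurable_compose[OF assms(3,1)] assms(2)])
     auto

text \<open>The indicators of the fibres of \<open>g\<close> sum to one. Writing the sum over
  \<open>y\<close> as an integral over \<open>count_space UNIV\<close> makes the exchange an
  instance of Tonelli.\<close>

lemma nn_integral_countable_partition: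
  fixes g :: "'z \<Rightarrow> 'x::countable"
  assumes g: "g \<in> M \<rightarrow>\<^sub>M count_space UNIV" and h: "h \<in> borel_measurable M"
  shows "(\<integral>\<^sup>+\<omega>. h \<omega> \<partial>M) = (\<integral>\<^sup>+y. (\<integral>\<^sup>+\<omega>. h \<omega> * indicator {y} (g \<omega>) \<partial>M) \<partial>count_space UNIV)"
proof -
  have "(\<integral>\<^sup>+y. indicator {y} (g \<omega>) \<partial>count_space UNIV) = (1::ennreal)" for \<omega>
  proof -
    have "(\<integral>\<^sup>+y. indicator {y} (g \<omega>) \<partial>count_space UNIV) = (\<integral>\<^sup>+y. indicator {g \<omega>} y \<partial>count_space UNIV)"
      by (intro nn_integral_cong) (auto split: split_indicator)
    then show ?thesis by simp
  qed
  then have "(\<integral>\<^sup>+\<omega>. h \<omega> \<partial>M) = (\<integral>\<^sup>+\<omega>. (\<integral>\<^sup>+y. h \<omega> * indicator {y} (g \<omega>) \<partial>count_space UNIV) \<partial>M)"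
    by (simp add: nn_integral_cmult)
  also have "\<dots> = (\<integral>\<^sup>+y. (\<integral>\<^sup>+\<omega>. h \<omega> * indicator {y} (g \<omega>) \<partial>M) \<partial>count_space UNIV)"
    using g h by (intro nn_integral_count_space_nn_integral) (auto intro!: measurable_compose[OF g])
  finally show ?thesis .
qed

text \<open>On an initial segment the projection in the definition of \<open>CI\<close> is the
  identity, which gives access to the recursion of \<open>C\<close>. The starting point
  \<open>\<lambda>_. undefined\<close> is the only point of the empty product.\<close>

lemma (in Ionescu_Tulcea) CI_atLeastLessThan: "CI {0..<n} = C 0 n (\<lambda>_. undefined)"
proof -
  have "up_to {0..<n} = n"
    by (rule antisym) (auto simp: up_to_iff dest: up_to_less[of "{0..<n}" "n - 1"],
        metis up_to_iff finite_atLeastLessThan atLeastLessThan_iff less_irrefl not_le zero_le order_refl)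
  then have "CI {0..<n} = distr (C 0 n (\<lambda>_. undefined)) (PiM {0..<n} M) (\<lambda>f. f)"
    unfolding CI_def
    by (intro distr_cong) (auto simp: space_C space_PiM)
  then show ?thesis
    using distr_id2[of "PiM {0..<n} M" "C 0 n (\<lambda>_. undefined)"] sets_C[of "\<lambda>_. undefined" 0 n] by simp
qed

section \<open>Integrals along a trajectory, one step at a time\<close>

context mdp
begin

lemma
  shows prob_space_kernel: "prob_space (p x a)"
    and sets_kernel [measurable_cong]: "sets (p x a) = sets outcome_space"
    and space_kernel [simp]: "space (p x a) = UNIV"
proof -
  show "prob_space (p x a)" and s: "sets (p x a) = sets outcome_space"
    using kernel[of x a] by (auto simp: space_prob_algebra)
  show "space (p x a) = UNIV"
    using sets_eq_imp_space_eq[OF s] by simp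
qed

lemma emeasure_kernel_UNIV [simp]: "emeasure (p x a) UNIV = 1"
  using prob_space.emeasure_space_1[OF prob_space_kernel[of x a]] by simp

lemma measurable_Pair_kernel [measurable]: "Pair a \<in> p x b \<rightarrow>\<^sub>M transition_space"
  unfolding transition_space_def by (simp add: measurable_cong_sets[OF sets_kernel refl])

lemma measurable_fst_kernel: "fst \<in> p x a \<rightarrow>\<^sub>M count_space UNIV"
  unfolding measurable_cong_sets[OF sets_kernel refl] outcome_space_def by simp

lemma sets_kernel_fst: "{z. fst z = y} \<in> sets (p x a)"
  using measurable_sets[OF measurable_fst_kernel, of "{y}"] by (simp add: vimage_def)

lemma nn_integral_transition_law:
  assumes g: "g \<in> borel_measurable transition_space"
  shows "(\<integral>\<^sup>+z. g z \<partial>transition_law p \<pi> t h) =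
    (\<Sum>a\<in>UNIV. ennreal (pmf (\<pi> t h) a) * (\<integral>\<^sup>+z. g (a, z) \<partial>p (state_at t h) a))"
proof -
  have "(\<lambda>a. distr (p (state_at t h) a) transition_space (Pair a))
      \<in> measure_pmf (\<pi> t h) \<rightarrow>\<^sub>M subprob_algebra transition_space"
    by (auto simp: space_subprob_algebra
        intro!: prob_space_imp_subprob_space prob_space.prob_space_distr prob_space_kernel)
  then have "(\<integral>\<^sup>+z. g z \<partial>transition_law p \<pi> t h) =
      (\<integral>\<^sup>+a. (\<integral>\<^sup>+z. g (a, z) \<partial>p (state_at t h) a) \<partial>measure_pmf (\<pi> t h))"
    unfolding transition_law_def using g
    by (subst nn_integral_bind[where B=transition_space]) (auto simp: nn_integral_distr)
  then show ?thesis
    by (subst (asm) nn_integral_measure_pmf_support[of UNIV]) (auto simp: mult.commute)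
qed

text \<open>The integrand sees only the first \<open>Suc t\<close> transitions, so it may be
  integrated against \<open>C 0 (Suc t)\<close>, whose last factor \<open>eP t\<close> is the
  transition law at time \<open>t\<close>. The policy is applied to a restricted sequence because
  its measurability is known only on \<open>history_space t\<close>, whose sequences are undefined
  from index \<open>t\<close> on.\<close>

lemma nn_integral_trajectory_step:
  assumes pi: "\<pi> \<in> history_policies" and f: "\<And>y. f y \<in> borel_measurable transition_space"
  shows "(\<integral>\<^sup>+\<omega>. f (state_at t (x, \<omega>)) (\<omega> t) \<partial>trajectory p \<pi> x) =
    (\<integral>\<^sup>+\<omega>. (\<Sum>a\<in>UNIV. ennreal (pmf (\<pi> t (x, restrict \<omega> {0..<t})) a) *
       (\<integral>\<^sup>+z. f (state_at t (x, \<omega>)) (a, z) \<partial>p (state_at t (x, \<omega>)) a)) \<partial>trajectory p \<pi> x)"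
proof -
  interpret IT: Ionescu_Tulcea "\<lambda>t \<omega>. transition_law p \<pi> t (x, \<omega>)" "\<lambda>_. transition_space"
    by (rule Ionescu_Tulcea_transition_law[OF pi])
  let ?P = "\<lambda>n. \<Pi>\<^sub>M i\<in>{0..<n}. transition_space"
  let ?G = "\<lambda>\<omega>. f (state_at t (x, \<omega>)) (\<omega> t)"
  let ?F = "\<lambda>\<omega>. \<integral>\<^sup>+z. f (state_at t (x, \<omega>)) z \<partial>transition_law p \<pi> t (x, \<omega>)"
  have law: "distr (trajectory p \<pi> x) (?P n) (\<lambda>\<omega>. restrict \<omega> {0..<n}) = IT.C 0 n (\<lambda>_. undefined)" for n
    using distr_trajectory[OF pi, of x n] by (simp only: IT.CI_atLeastLessThan)
  have restr: "(\<lambda>\<omega>. restrict \<omega> {0..<n}) \<in> trajectory p \<pi> x \<rightarrow>\<^sub>M ?P n" for n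
    unfolding measurable_cong_sets[OF sets_trajectory[OF pi] refl]
    by (rule measurable_restrict_subset) simp
  have G: "?G \<in> borel_measurable (?P (Suc t))"
    by (rule measurable_countable_param[OF f measurable_state_at_PiM measurable_component_singleton]) auto
  then have G': "?G \<in> borel_measurable (distr N (?P (Suc t)) g)" for N :: "(nat \<Rightarrow> ('x, 'a) transition) measure" and g
    by simp
  have F: "?F \<in> borel_measurable (?P t)"
  proof (rule nn_integral_measurable_subprob_algebra2[OF _ IT.P])
    show "(\<lambda>(\<omega>, z). f (state_at t (x, \<omega>)) z) \<in> borel_measurable (?P t \<Otimes>\<^sub>M transition_space)"
      unfolding case_prod_beta
      by (rule measurable_countable_param[OF f])
         (auto intro: measurable_compose[OF measurable_fst measurable_state_at_PiM])
  qed
  then have F': "?F \<in> borel_measurable (distr N (?P t) g)" for N :: "(nat \<Rightarrow> ('x, 'a) transition) measure" and g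
    by simp
  have "(\<integral>\<^sup>+\<omega>. ?G \<omega> \<partial>trajectory p \<pi> x) = (\<integral>\<^sup>+\<omega>. ?G (restrict \<omega> {0..<Suc t}) \<partial>trajectory p \<pi> x)"
    by (intro nn_integral_cong arg_cong2[of _ _ _ _ f] state_at_cong) auto
  also have "\<dots> = (\<integral>\<^sup>+\<omega>. ?G \<omega> \<partial>IT.C 0 (Suc t) (\<lambda>_. undefined))"
    by (simp only: nn_integral_distr[OF restr G'] flip: law)
  also have "\<dots> = (\<integral>\<^sup>+\<omega>. (\<integral>\<^sup>+\<omega>'. ?G \<omega>' \<partial>IT.eP t \<omega>) \<partial>IT.C 0 t (\<lambda>_. undefined))"
    using IT.measurable_eP[of t] IT.sets_C[of "\<lambda>_. undefined" 0 t]
    by (simp only: IT.C.simps add_0_left, subst nn_integral_bind[OF G])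
       (auto cong: measurable_cong_sets)
  also have "\<dots> = (\<integral>\<^sup>+\<omega>. ?F \<omega> \<partial>IT.C 0 t (\<lambda>_. undefined))"
  proof (rule nn_integral_cong)
    fix \<omega> assume "\<omega> \<in> space (IT.C 0 t (\<lambda>_. undefined))"
    then have "\<omega> \<in> space (?P t)" by (simp add: IT.space_C)
    moreover have "state_at t (x, fun_upd \<omega> t z) = state_at t (x, \<omega>)" for z
      by (rule state_at_cong) simp
    ultimately show "(\<integral>\<^sup>+\<omega>'. ?G \<omega>' \<partial>IT.eP t \<omega>) = ?F \<omega>"
      by (simp add: IT.nn_integral_eP[OF _ G])
  qed
  also have "\<dots> = (\<integral>\<^sup>+\<omega>. ?F (restrict \<omega> {0..<t}) \<partial>trajectory p \<pi> x)"
    by (simp only: nn_integral_distr[OF restr F'] flip: law)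
  finally show ?thesis
    by (simp only: nn_integral_transition_law[OF f] state_at_restrict)
qed

section \<open>Occupation measures and marginal state laws\<close>

text \<open>The joint law of state and action at time \<open>t\<close>. It takes values in
  \<open>ennreal\<close> because its sum over \<open>t\<close>, the total occupation, may be
  infinite in absorbing states.\<close>

definition occupation :: "('x, 'a) policy \<Rightarrow> 'x \<Rightarrow> nat \<Rightarrow> 'x \<Rightarrow> 'a \<Rightarrow> ennreal" where
  "occupation \<pi> x t y a =
     (\<integral>\<^sup>+\<omega>. indicator {y} (state_at t (x, \<omega>)) * indicator {a} (fst (\<omega> t)) \<partial>trajectory p \<pi> x)"

definition state_law :: "('x, 'a) policy \<Rightarrow> 'x \<Rightarrow> nat \<Rightarrow> 'x \<Rightarrow> ennreal" where
  "state_law \<pi> x t y = (\<integral>\<^sup>+\<omega>. indicator {y} (state_at t (x, \<omega>)) \<partial>trajectory p \<pi> x)"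

lemma measurable_action [measurable]:
  "fst \<in> (transition_space :: ('x, 'a) transition measure) \<rightarrow>\<^sub>M count_space UNIV"
  by (simp add: transition_space_def)


lemma measurable_policy_trajectory:
  assumes pi: "\<pi> \<in> history_policies"
  shows "(\<lambda>\<omega>. ennreal (pmf (\<pi> t (x, restrict \<omega> {0..<t})) a)) \<in> borel_measurable (trajectory p \<pi> x)"
proof -
  have "(\<lambda>\<omega>. (x, restrict \<omega> {0..<t})) \<in> trajectory p \<pi> x \<rightarrow>\<^sub>M history_space t"
    unfolding measurable_cong_sets[OF sets_trajectory[OF pi] refl] history_space_def
    by (intro measurable_Pair measurable_const measurable_restrict_subset) auto
  moreover have "(\<lambda>h. measure_pmf (\<pi> t h)) \<in> history_space t \<rightarrow>\<^sub>M subprob_algebra (count_space UNIV)"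
    using pi by (intro measurable_prob_algebraD) (simp add: history_policies_def)
  ultimately have "(\<lambda>\<omega>. emeasure (measure_pmf (\<pi> t (x, restrict \<omega> {0..<t}))) {a})
      \<in> borel_measurable (trajectory p \<pi> x)"
    by (rule measurable_compose[OF measurable_compose measurable_emeasure_subprob_algebra]) simp
  then show ?thesis by (simp add: emeasure_pmf_single)
qed

lemma measurable_state_at_trajectory:
  assumes "\<pi> \<in> history_policies"
  shows "(\<lambda>\<omega>. state_at t (x, \<omega>)) \<in> trajectory p \<pi> y \<rightarrow>\<^sub>M count_space UNIV"
  unfolding measurable_cong_sets[OF sets_trajectory[OF assms] refl]
  by (rule measurable_state_at_PiM) simp

lemma measurable_transition_trajectory:
  assumes "\<pi> \<in> history_policies"
  shows "(\<lambda>\<omega>. \<omega> t) \<in> trajectory p \<pi> y \<rightarrow>\<^sub>M transition_space"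
  unfolding measurable_cong_sets[OF sets_trajectory[OF assms] refl] by simp

text \<open>Conditioning on the first \<open>t\<close> transitions replaces the indicator of the
  chosen action by its conditional probability.\<close>

lemma occupation_eq:
  assumes pi: "\<pi> \<in> history_policies"
  shows "occupation \<pi> x t y a = (\<integral>\<^sup>+\<omega>. indicator {y} (state_at t (x, \<omega>)) *
    ennreal (pmf (\<pi> t (x, restrict \<omega> {0..<t})) a) \<partial>trajectory p \<pi> x)"
proof -
  have "occupation \<pi> x t y a = (\<integral>\<^sup>+\<omega>. (\<Sum>b\<in>UNIV. ennreal (pmf (\<pi> t (x, restrict \<omega> {0..<t})) b) *
       (\<integral>\<^sup>+z. indicator {y} (state_at t (x, \<omega>)) * indicator {a} b \<partial>p (state_at t (x, \<omega>)) b))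
       \<partial>trajectory p \<pi> x)"
    unfolding occupation_def
    by (subst nn_integral_trajectory_step[OF pi, where f="\<lambda>s z. indicator {y} s * indicator {a} (fst z)"])
       auto
  also have "\<dots> = (\<integral>\<^sup>+\<omega>. indicator {y} (state_at t (x, \<omega>)) *
      ennreal (pmf (\<pi> t (x, restrict \<omega> {0..<t})) a) \<partial>trajectory p \<pi> x)"
    by (intro nn_integral_cong)
       (simp add: sum.remove[of UNIV a] mult.commute)
  finally show ?thesis .
qed

text \<open>On the event that the current state is \<open>y\<close>, the kernel integrals are
  constants and factor out. Hence the policy enters one-step expectations only through its
  occupation.\<close>

lemma nn_integral_trajectory_occupation:
  assumes pi: "\<pi> \<in> history_policies" and f: "\<And>y. f y \<in> borel_measurable transition_space"
  shows "(\<integral>\<^sup>+\<omega>. f (state_at t (x, \<omega>)) (\<omega> t) \<partial>trajectory p \<pi> x) =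
    (\<integral>\<^sup>+y. (\<Sum>a\<in>UNIV. occupation \<pi> x t y a * (\<integral>\<^sup>+z. f y (a, z) \<partial>p y a)) \<partial>count_space UNIV)"
proof -
  note [measurable] = measurable_state_at_trajectory[OF pi] measurable_policy_trajectory[OF pi]
  let ?k = "\<lambda>y a. \<integral>\<^sup>+z. f y (a, z) \<partial>p y a"
  let ?h = "\<lambda>\<omega>. \<Sum>a\<in>UNIV. ennreal (pmf (\<pi> t (x, restrict \<omega> {0..<t})) a) * ?k (state_at t (x, \<omega>)) a"
  have k: "(\<lambda>\<omega>. ?k (state_at t (x, \<omega>)) a) \<in> borel_measurable (trajectory p \<pi> x)" for a
    by (rule measurable_compose[OF measurable_state_at_trajectory[OF pi]]) simp
  have "(\<integral>\<^sup>+\<omega>. f (state_at t (x, \<omega>)) (\<omega> t) \<partial>trajectory p \<pi> x) = (\<integral>\<^sup>+\<omega>. ?h \<omega> \<partial>trajectory p \<pi> x)"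
    by (rule nn_integral_trajectory_step[OF pi f])
  also have "\<dots> = (\<integral>\<^sup>+y. (\<integral>\<^sup>+\<omega>. ?h \<omega> * indicator {y} (state_at t (x, \<omega>)) \<partial>trajectory p \<pi> x)
      \<partial>count_space UNIV)"
    by (intro nn_integral_countable_partition measurable_state_at_trajectory[OF pi]
        borel_measurable_sum borel_measurable_times_ennreal k measurable_policy_trajectory[OF pi])
  also have "\<dots> = (\<integral>\<^sup>+y. (\<Sum>a\<in>UNIV. occupation \<pi> x t y a * ?k y a) \<partial>count_space UNIV)"
  proof (rule nn_integral_cong)
    fix y
    have "(\<integral>\<^sup>+\<omega>. ?h \<omega> * indicator {y} (state_at t (x, \<omega>)) \<partial>trajectory p \<pi> x) =
      (\<integral>\<^sup>+\<omega>. (\<Sum>a\<in>UNIV. indicator {y} (state_at t (x, \<omega>)) *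
        ennreal (pmf (\<pi> t (x, restrict \<omega> {0..<t})) a) * ?k y a) \<partial>trajectory p \<pi> x)"
      by (intro nn_integral_cong) (auto split: split_indicator)
    also have "\<dots> = (\<Sum>a\<in>UNIV. occupation \<pi> x t y a * ?k y a)"
      unfolding occupation_eq[OF pi]
      by (subst nn_integral_sum) (auto simp: nn_integral_multc)
    finally show "(\<integral>\<^sup>+\<omega>. ?h \<omega> * indicator {y} (state_at t (x, \<omega>)) \<partial>trajectory p \<pi> x) = \<dots>" .
  qed
  finally show ?thesis .
qed

lemma state_law_eq_sum:
  assumes pi: "\<pi> \<in> history_policies"
  shows "state_law \<pi> x t y = (\<Sum>a\<in>UNIV. occupation \<pi> x t y a)"
proof -
  note [measurable] = measurable_state_at_trajectory[OF pi]
    measurable_compose[OF measurable_transition_trajectory[OF pi] measurable_action]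
  have "(\<Sum>a\<in>UNIV. occupation \<pi> x t y a) =
      (\<integral>\<^sup>+\<omega>. (\<Sum>a\<in>UNIV. indicator {y} (state_at t (x, \<omega>)) * indicator {a} (fst (\<omega> t))) \<partial>trajectory p \<pi> x)"
    unfolding occupation_def by (subst nn_integral_sum) auto
  also have "\<dots> = state_law \<pi> x t y"
    unfolding state_law_def
    by (intro nn_integral_cong) (auto simp: indicator_def if_distrib cong: if_cong)
  finally show ?thesis ..
qed

lemma nn_integral_state_at:
  assumes pi: "\<pi> \<in> history_policies"
  shows "(\<integral>\<^sup>+\<omega>. g (state_at t (x, \<omega>)) \<partial>trajectory p \<pi> x) =
    (\<integral>\<^sup>+y. state_law \<pi> x t y * g y \<partial>count_space UNIV)"
  by (subst nn_integral_trajectory_occupation[OF pi, where f="\<lambda>y z. g y"])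
     (simp_all add: state_law_eq_sum[OF pi] sum_distrib_right)

lemma state_law_0:
  assumes pi: "\<pi> \<in> history_policies"
  shows "state_law \<pi> x 0 y = indicator {x} y"
  using prob_space.emeasure_space_1[OF prob_space_trajectory[OF pi, of x]]
  by (simp add: state_law_def indicator_def)

text \<open>The forward equation. Summed over \<open>t\<close> it becomes the flow equation for
  total occupations, and its supports drive the induction behind feasibility.\<close>

lemma state_law_Suc:
  assumes pi: "\<pi> \<in> history_policies"
  shows "state_law \<pi> x (Suc t) y' =
    (\<integral>\<^sup>+y. (\<Sum>a\<in>UNIV. occupation \<pi> x t y a * emeasure (p y a) {z. fst z = y'}) \<partial>count_space UNIV)"
proof -
  have "(\<integral>\<^sup>+z. indicator {y'} (next_state (a, z)) \<partial>p y a) = emeasure (p y a) {z. fst z = y'}" for y a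
  proof -
    have "{z. fst z = y'} \<in> sets (p y a)" by (rule sets_kernel_fst)
    moreover have "(\<lambda>z. indicator {y'} (next_state (a, z))) = (indicator {z. fst z = y'} :: _ \<Rightarrow> ennreal)"
      by (auto simp: fun_eq_iff next_state_def indicator_def)
    ultimately show ?thesis by simp
  qed
  then show ?thesis
    unfolding state_law_def state_at.simps
    by (subst nn_integral_trajectory_occupation[OF pi, where f="\<lambda>y z. indicator {y'} (next_state z)"])
       (auto intro: measurable_compose[OF measurable_next_state])
qed

lemma occupation_stationary:
  assumes pi: "\<pi> \<in> history_policies" and eq: "\<pi> = (\<lambda>t h. \<phi> (state_at t h))"
  shows "occupation \<pi> x t y a = state_law \<pi> x t y * ennreal (pmf (\<phi> y) a)"
proof -
  note [measurable] = measurable_state_at_trajectory[OF pi]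
  have "occupation \<pi> x t y a =
      (\<integral>\<^sup>+\<omega>. indicator {y} (state_at t (x, \<omega>)) * ennreal (pmf (\<phi> y) a) \<partial>trajectory p \<pi> x)"
    unfolding occupation_eq[OF pi] by (intro nn_integral_cong) (auto simp: eq split: split_indicator)
  then show ?thesis
    unfolding state_law_def by (simp add: nn_integral_multc)
qed

text \<open>The probability of damage at time \<open>t\<close> is a countable sum of nonnegative
  terms and vanishes iff each of them does. Feasibility therefore depends only on which state-action
  pairs have positive occupation, not on how large it is.\<close>

lemma feasible_iff:
  assumes pi: "\<pi> \<in> history_policies"
  shows "feasible p x \<pi> \<longleftrightarrow>
    (\<forall>t y a. occupation \<pi> x t y a = 0 \<or> emeasure (p y a) {z. snd (snd z)} = 0)"
proof -
  interpret prob_space "trajectory p \<pi> x" by (rule prob_space_trajectory[OF pi])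
  note [measurable] = measurable_compose[OF measurable_transition_trajectory[OF pi] measurable_damage]
  have *: "(\<integral>\<^sup>+z. indicator {z. damage z} (a, z) \<partial>p y a) = emeasure (p y a) {z. snd (snd z)}" for y a
  proof -
    have "(\<lambda>z. snd (snd z)) \<in> p y a \<rightarrow>\<^sub>M count_space UNIV"
      unfolding measurable_cong_sets[OF sets_kernel refl] outcome_space_def by simp
    then have "{z. snd (snd z)} \<in> sets (p y a)"
      using measurable_sets[of "\<lambda>z. snd (snd z)" "p y a" "count_space UNIV" "{True}"] by (simp add: vimage_def)
    moreover have "(\<lambda>z. indicator {z. damage z} (a, z)) = (indicator {z. snd (snd z)} :: _ \<Rightarrow> ennreal)"
      by (auto simp: fun_eq_iff damage_def indicator_def)
    ultimately show ?thesis by (metis nn_integral_indicator)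
  qed
  have "\<P>(\<omega> in trajectory p \<pi> x. \<not> damage (\<omega> t)) = 1 \<longleftrightarrow>
      (\<forall>y a. occupation \<pi> x t y a = 0 \<or> emeasure (p y a) {z. snd (snd z)} = 0)" for t
  proof -
    have "\<P>(\<omega> in trajectory p \<pi> x. \<not> damage (\<omega> t)) = 1 \<longleftrightarrow> (AE \<omega> in trajectory p \<pi> x. \<not> damage (\<omega> t))"
      by (rule prob_Collect_eq_1) simp
    also have "\<dots> \<longleftrightarrow> (\<integral>\<^sup>+\<omega>. indicator {z. damage z} (\<omega> t) \<partial>trajectory p \<pi> x) = 0"
      by (subst nn_integral_0_iff_AE) (auto simp: indicator_def)
    also have "(\<integral>\<^sup>+\<omega>. indicator {z. damage z} (\<omega> t) \<partial>trajectory p \<pi> x) =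
      (\<integral>\<^sup>+y. (\<Sum>a\<in>UNIV. occupation \<pi> x t y a * emeasure (p y a) {z. snd (snd z)}) \<partial>count_space UNIV)"
      by (subst nn_integral_trajectory_occupation[OF pi, where f="\<lambda>y. indicator {z. damage z}"])
         (auto simp: *)
    finally show ?thesis
      by (simp add: nn_integral_0_iff_AE AE_count_space)
  qed
  then show ?thesis unfolding feasible_def by blast
qed

end


subsection \<open>Absorbing processes with a Lyapunov function\<close>

text \<open>The excess \<open>z = y - y'\<close> satisfies \<open>z \<le> z P\<close>, which the drift of \<open>V\<close> only allows for \<open>z = 0\<close>.\<close>

lemma flow_le:
  fixes y y' \<delta> V :: "'x::countable \<Rightarrow> ennreal" and P :: "'x \<Rightarrow> 'x \<Rightarrow> ennreal"
  assumes y: "\<And>x'. y x' \<le> \<delta> x' + (\<integral>\<^sup>+x. y x * P x x' \<partial>count_space UNIV)"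
    and y': "\<And>x'. \<delta> x' + (\<integral>\<^sup>+x. y' x * P x x' \<partial>count_space UNIV) \<le> y' x'"
    and drift: "\<And>x. y x \<noteq> 0 \<Longrightarrow> (\<integral>\<^sup>+x'. P x x' * V x' \<partial>count_space UNIV) + 1 \<le> V x"
    and finite: "(\<integral>\<^sup>+x. y x * V x \<partial>count_space UNIV) < \<top>" "\<And>x. y' x < \<top>"
  shows "y x \<le> y' x"
proof -
  \<comment> \<open>Subtraction in \<open>ennreal\<close> truncates at zero, so \<open>z\<close> is
    the positive part of the excess and \<open>y x \<le> y' x + z x\<close> holds in both
    cases.\<close>
  define z where "z x = y x - y' x" for x
  let ?I = "\<lambda>f. \<integral>\<^sup>+x. f x \<partial>count_space (UNIV :: 'x set)"
  have "z x' \<le> ?I (\<lambda>x. z x * P x x')" for x'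
  proof -
    have le: "y x \<le> y' x + z x" for x
      using linear[of "y x" "y' x"] by (auto simp: z_def add_diff_self_ennreal)
    have "y x' \<le> \<delta> x' + ?I (\<lambda>x. y x * P x x')" by (rule y)
    also have "\<dots> \<le> \<delta> x' + ?I (\<lambda>x. (y' x + z x) * P x x')"
      by (intro add_left_mono nn_integral_mono mult_right_mono le) auto
    also have "\<dots> = (\<delta> x' + ?I (\<lambda>x. y' x * P x x')) + ?I (\<lambda>x. z x * P x x')"
      by (simp add: distrib_right nn_integral_add add.assoc)
    also have "\<dots> \<le> y' x' + ?I (\<lambda>x. z x * P x x')"
      by (intro add_right_mono y')
    finally show ?thesis
      using finite(2)[of x'] by (auto simp: z_def ennreal_minus_le_iff)
  qed
  then have "?I (\<lambda>x. z x * V x) \<le> ?I (\<lambda>x'. ?I (\<lambda>x. z x * P x x') * V x')"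
    by (intro nn_integral_mono mult_right_mono) auto
  also have "\<dots> = ?I (\<lambda>x'. ?I (\<lambda>x. z x * (P x x' * V x')))"
    by (simp add: mult.assoc flip: nn_integral_multc)
  also have "\<dots> = ?I (\<lambda>x. ?I (\<lambda>x'. z x * (P x x' * V x')))"
    by (rule nn_integral_count_space_nn_integral) auto
  also have "\<dots> = ?I (\<lambda>x. z x * ?I (\<lambda>x'. P x x' * V x'))"
    by (simp add: nn_integral_cmult)
  finally have "?I (\<lambda>x. z x * V x) + ?I z \<le> ?I (\<lambda>x. z x * ?I (\<lambda>x'. P x x' * V x')) + ?I z"
    by (rule add_right_mono)
  also have "\<dots> = ?I (\<lambda>x. z x * (?I (\<lambda>x'. P x x' * V x') + 1))"
    by (simp add: distrib_left nn_integral_add)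
  also have "\<dots> \<le> ?I (\<lambda>x. z x * V x)"
  proof (intro nn_integral_mono)
    \<comment> \<open>The drift is assumed only where \<open>y\<close> is nonzero; elsewhere
      \<open>z\<close> vanishes too.\<close>
    fix x show "z x * (?I (\<lambda>x'. P x x' * V x') + 1) \<le> z x * V x"
      using drift[of x] by (cases "y x = 0") (auto simp: z_def intro: mult_left_mono)
  qed
  \<comment> \<open>The \<open>V\<close>-weighted mass of \<open>z\<close> is finite, being below
    that of \<open>y\<close>, so it cancels and leaves the plain mass of \<open>z\<close> equal to
    zero.\<close>
  finally have "?I (\<lambda>x. z x * V x) + ?I z \<le> ?I (\<lambda>x. z x * V x) + 0" by simp
  moreover have "?I (\<lambda>x. z x * V x) \<le> ?I (\<lambda>x. y x * V x)"
    by (intro nn_integral_mono mult_right_mono) (auto simp: z_def)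
  then have "?I (\<lambda>x. z x * V x) \<noteq> \<infinity>"
    using finite(1) by (auto simp: less_top)
  ultimately have "?I z = 0"
    by (simp only: ennreal_add_left_cancel_le) auto
  then have "z x = 0"
    by (simp add: nn_integral_0_iff_AE AE_count_space)
  then show ?thesis
    by (simp add: z_def diff_eq_0_iff_ennreal)
qed

text \<open>Normalisation by the total mass, done in the reals, where the two hypotheses make the
  quotients meaningful. The product form of the conclusion avoids division of extended
  numbers.\<close>

lemma ex_pmf_proportional:
  fixes w :: "'a::finite \<Rightarrow> ennreal"
  assumes "(\<Sum>a\<in>UNIV. w a) \<noteq> 0" "(\<Sum>a\<in>UNIV. w a) < \<top>"
  obtains q where "\<And>a. w a = (\<Sum>a\<in>UNIV. w a) * ennreal (pmf q a)"
proof -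
  let ?S = "\<Sum>a\<in>UNIV. w a"
  define f where "f a = enn2real (w a) / enn2real ?S" for a
  have pos: "enn2real ?S > 0"
    using assms by (simp add: enn2real_positive_iff zero_less_iff_neq_zero)
  have w: "w a < \<top>" for a
    using assms(2) by simp
  have "(\<Sum>a\<in>UNIV. enn2real (w a)) = enn2real ?S"
    using w by (subst enn2real_sum) auto
  then have "(\<Sum>a\<in>UNIV. f a) = 1"
    using pos by (simp add: f_def flip: sum_divide_distrib)
  then have pmf: "pmf (embed_pmf f) a = f a" for a
    by (intro pmf_embed_pmf) (auto simp: f_def nn_integral_count_space_finite)
  show ?thesis
  proof (rule that)
    fix a
    have "?S * ennreal (f a) = ennreal (enn2real ?S) * ennreal (f a)"
      using assms(2) by simp
    also have "\<dots> = ennreal (enn2real (w a))"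
      using pos by (simp add: f_def flip: ennreal_mult)
    finally show "w a = ?S * ennreal (pmf (embed_pmf f) a)" using w[of a] by (simp only: pmf) simp
  qed
qed

lemma nn_integral_state_kernel:
  fixes p :: "('x::countable, 'a::finite) kernel"
  assumes "mdp p"
  shows "(\<integral>\<^sup>+x'. emeasure (p x a) {z. fst z = x'} * V x' \<partial>count_space UNIV) = (\<integral>\<^sup>+z. V (fst z) \<partial>p x a)"
proof -
  interpret mdp p by fact
  note m = measurable_fst_kernel[of x a]
  have "(\<integral>\<^sup>+z. V (fst z) \<partial>p x a) = (\<integral>\<^sup>+x'. (\<integral>\<^sup>+z. V (fst z) * indicator {x'} (fst z) \<partial>p x a) \<partial>count_space UNIV)"
    by (rule nn_integral_countable_partition) (auto intro: m measurable_compose[OF m])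
  also have "\<dots> = (\<integral>\<^sup>+x'. (\<integral>\<^sup>+z. V x' * indicator {z. fst z = x'} z \<partial>p x a) \<partial>count_space UNIV)"
    by (intro nn_integral_cong) (auto split: split_indicator)
  also have "\<dots> = (\<integral>\<^sup>+x'. emeasure (p x a) {z. fst z = x'} * V x' \<partial>count_space UNIV)"
    by (simp add: sets_kernel_fst nn_integral_cmult_indicator mult.commute)
  finally show ?thesis ..
qed

text \<open>Absorption is into a set, since in the augmented process the termination state occurs
  with every budget. The state space may be infinite, so the uniform bounds \<open>B\<close> and
  \<open>C\<close> replace arguments by finiteness.\<close>

locale absorbing_mdp = mdp p
  for p :: "('x::countable, 'a::finite) kernel" +
  fixes E :: "'x set" and V :: "'x \<Rightarrow> ennreal" and B C :: real
  assumes V_absorbed: "x \<in> E \<Longrightarrow> V x = 0"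
    and V_le: "V x \<le> ennreal B"
    and drift: "x \<notin> E \<Longrightarrow> (\<integral>\<^sup>+z. V (fst z) \<partial>p x a) + 1 \<le> V x"
    and absorbed: "x \<in> E \<Longrightarrow> AE z in p x a. fst z \<in> E \<and> fst (snd z) = 0"
    and reward_le: "(\<integral>\<^sup>+z. ennreal \<bar>fst (snd z)\<bar> \<partial>p x a) \<le> ennreal C"
begin

text \<open>In each step the expectation of \<open>V\<close> at the current state drops by at least
  the probability of not being absorbed. Telescoping bounds the expected time outside
  \<open>E\<close> by the initial value of \<open>V\<close>.\<close>

lemma sum_state_law_le:
  assumes pi: "\<pi> \<in> history_policies"
  shows "(\<integral>\<^sup>+y. (\<Sum>t. state_law \<pi> x t y) * indicator (- E) y \<partial>count_space UNIV) \<le> V x"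
proof -
  let ?T = "trajectory p \<pi> x"
  let ?v = "\<lambda>t. \<integral>\<^sup>+\<omega>. V (state_at t (x, \<omega>)) \<partial>?T"
  let ?u = "\<lambda>t. \<integral>\<^sup>+\<omega>. indicator (- E) (state_at t (x, \<omega>)) \<partial>?T"
  note [measurable] = measurable_state_at_trajectory[OF pi]
  have next_V: "(\<lambda>z. V (next_state z)) \<in> borel_measurable transition_space"
    by (rule measurable_compose[OF measurable_next_state]) simp
  have step: "?v (Suc t) + ?u t \<le> ?v t" for t
  proof -
    have "?v (Suc t) + ?u t =
        (\<integral>\<^sup>+\<omega>. V (next_state (\<omega> t)) + indicator (- E) (state_at t (x, \<omega>)) \<partial>?T)"
      by (subst nn_integral_add)
         (auto intro!: measurable_compose[OF measurable_transition_trajectory[OF pi] next_V])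
    also have "\<dots> = (\<integral>\<^sup>+y. (\<Sum>a\<in>UNIV. occupation \<pi> x t y a *
        (\<integral>\<^sup>+z. V (next_state (a, z)) + indicator (- E) y \<partial>p y a)) \<partial>count_space UNIV)"
      using next_V
      by (subst nn_integral_trajectory_occupation[OF pi, where f="\<lambda>y z. V (next_state z) + indicator (- E) y"])
         auto
    also have "\<dots> \<le> (\<integral>\<^sup>+y. (\<Sum>a\<in>UNIV. occupation \<pi> x t y a * V y) \<partial>count_space UNIV)"
    proof (intro nn_integral_mono sum_mono mult_left_mono)
      fix y a
      have m: "(\<lambda>z. V (next_state (a, z))) \<in> borel_measurable (p y a)"
        by (rule measurable_compose[OF measurable_Pair_kernel next_V])
      show "(\<integral>\<^sup>+z. V (next_state (a, z)) + indicator (- E) y \<partial>p y a) \<le> V y"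
      proof (cases "y \<in> E")
        \<comment> \<open>In \<open>E\<close> no drift is assumed, but the next state is almost
          surely in \<open>E\<close>, where \<open>V\<close> vanishes.\<close>
        case True
        then have "AE z in p y a. V (next_state (a, z)) = 0"
          using absorbed[OF True, of a] V_absorbed by (auto simp: next_state_def)
        then have "(\<integral>\<^sup>+z. V (next_state (a, z)) \<partial>p y a) = (\<integral>\<^sup>+z. 0 \<partial>p y a)"
          by (rule nn_integral_cong_AE)
        then show ?thesis using True by (simp add: indicator_def)
      next
        case False
        with m drift[OF False, of a] show ?thesis
          by (subst nn_integral_add) (auto simp: next_state_def)
      qed
    qed simp
    also have "\<dots> = ?v t"
      by (simp add: nn_integral_state_at[OF pi] state_law_eq_sum[OF pi] sum_distrib_right)
    finally show ?thesis .
  qed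
  \<comment> \<open>Keeping the remaining expectation \<open>?v n\<close> on the left avoids
    subtraction in \<open>ennreal\<close>; it is dropped afterwards.\<close>
  have "(\<Sum>t<n. ?u t) + ?v n \<le> V x" for n
  proof (induction n)
    case 0
    show ?case
      using prob_space.emeasure_space_1[OF prob_space_trajectory[OF pi, of x]] by simp
  next
    case (Suc n)
    have "(\<Sum>t<Suc n. ?u t) + ?v (Suc n) = (\<Sum>t<n. ?u t) + (?v (Suc n) + ?u n)"
      by (simp add: ac_simps)
    also have "\<dots> \<le> (\<Sum>t<n. ?u t) + ?v n"
      by (intro add_left_mono step)
    finally show ?case using Suc by (rule order_trans)
  qed
  then have "(\<Sum>t<n. ?u t) \<le> V x" for n
    by (rule order_trans[rotated, OF _ add_increasing2]) auto
  then have "(\<Sum>t. ?u t) \<le> V x"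
    by (intro suminf_le_const) auto
  moreover have "(\<integral>\<^sup>+y. (\<Sum>t. state_law \<pi> x t y) * indicator (- E) y \<partial>count_space UNIV) = (\<Sum>t. ?u t)"
    by (subst nn_integral_state_at[OF pi], subst nn_integral_suminf[symmetric]) auto
  ultimately show ?thesis by simp
qed

lemma sum_state_law_finite:
  assumes pi: "\<pi> \<in> history_policies" and "y \<notin> E"
  shows "(\<Sum>t. state_law \<pi> x t y) < \<top>"
proof -
  have "(\<Sum>t. state_law \<pi> x t y) = (\<integral>\<^sup>+y'. (\<Sum>t. state_law \<pi> x t y') * indicator (- E) y' * indicator {y} y' \<partial>count_space UNIV)"
    using assms(2) by (simp add: nn_integral_indicator_singleton)
  also have "\<dots> \<le> (\<integral>\<^sup>+y'. (\<Sum>t. state_law \<pi> x t y') * indicator (- E) y' \<partial>count_space UNIV)"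
    by (intro nn_integral_mono) (auto split: split_indicator)
  also have "\<dots> \<le> ennreal B"
    using sum_state_law_le[OF pi] V_le by (rule order_trans)
  finally show ?thesis by (rule le_less_trans) simp
qed

lemma sum_occupation:
  assumes pi: "\<pi> \<in> history_policies"
  shows "(\<Sum>a\<in>UNIV. \<Sum>t. occupation \<pi> x t y a) = (\<Sum>t. state_law \<pi> x t y)"
  unfolding state_law_eq_sum[OF pi] by (rule suminf_sum[symmetric]) auto

section \<open>Total occupations outside the absorbing set as solutions of a flow equation\<close>

text \<open>\<open>\<phi>\<close> gives the conditional action probabilities under the total
  occupation. The product form leaves \<open>\<phi> y\<close> arbitrary in states that are never
  visited; states of \<open>E\<close> are excluded because their totals may be infinite.\<close>

definition proportional :: "('x, 'a) policy \<Rightarrow> 'x \<Rightarrow> ('x \<Rightarrow> 'a pmf) \<Rightarrow> bool" where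
  "proportional \<pi> x \<phi> \<longleftrightarrow> (\<forall>y a. y \<notin> E \<longrightarrow>
     (\<Sum>t. occupation \<pi> x t y a) = (\<Sum>t. state_law \<pi> x t y) * ennreal (pmf (\<phi> y) a))"

text \<open>The state kernel under \<open>\<phi>\<close>, killed on entry to \<open>E\<close> and
  hence in general only substochastic.\<close>

definition transient_kernel :: "('x \<Rightarrow> 'a pmf) \<Rightarrow> 'x \<Rightarrow> 'x \<Rightarrow> ennreal" where
  "transient_kernel \<phi> y y' =
     (\<Sum>a\<in>UNIV. ennreal (pmf (\<phi> y) a) * emeasure (p y a) {z. fst z = y'}) * indicator (- E) y'"

text \<open>The forward equation is summed over \<open>t\<close>, with the law at time zero as
  source. Proportionality turns the sums over actions into \<open>transient_kernel\<close>, and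
  \<open>E\<close> sends no mass back outside.\<close>

lemma transient_flow:
  assumes pi: "\<pi> \<in> history_policies" and pr: "proportional \<pi> x \<phi>"
  shows "(\<Sum>t. state_law \<pi> x t y') * indicator (- E) y' = indicator {x} y' * indicator (- E) y' +
    (\<integral>\<^sup>+y. ((\<Sum>t. state_law \<pi> x t y) * indicator (- E) y) * transient_kernel \<phi> y y' \<partial>count_space UNIV)"
proof (cases "y' \<in> E")
  case False
  let ?q = "\<lambda>y a. emeasure (p y a) {z. fst z = y'}"
  have "(\<Sum>t. state_law \<pi> x t y') = (\<Sum>t. state_law \<pi> x (Suc t) y') + indicator {x} y'"
    by (subst suminf_offset[where i=1]) (auto simp: state_law_0[OF pi])
  also have "(\<Sum>t. state_law \<pi> x (Suc t) y') =
      (\<integral>\<^sup>+y. (\<Sum>t. \<Sum>a\<in>UNIV. occupation \<pi> x t y a * ?q y a) \<partial>count_space UNIV)"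
    unfolding state_law_Suc[OF pi] by (rule nn_integral_suminf[symmetric]) simp
  also have "\<dots> = (\<integral>\<^sup>+y. ((\<Sum>t. state_law \<pi> x t y) * indicator (- E) y) * transient_kernel \<phi> y y' \<partial>count_space UNIV)"
  proof (rule nn_integral_cong)
    fix y
    have "(\<Sum>t. \<Sum>a\<in>UNIV. occupation \<pi> x t y a * ?q y a) = (\<Sum>a\<in>UNIV. (\<Sum>t. occupation \<pi> x t y a) * ?q y a)"
      by (subst suminf_sum) auto
    also have "\<dots> = ((\<Sum>t. state_law \<pi> x t y) * indicator (- E) y) * transient_kernel \<phi> y y'"
    proof (cases "y \<in> E")
      case True
      have "?q y a = 0" for a
      proof -
        have "AE z in p y a. \<not> fst z = y'" using absorbed[OF True, of a] False by auto
        then show ?thesis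
          by (subst (asm) AE_iff_measurable[OF sets_kernel_fst[of y' y a]]) auto
      qed
      then show ?thesis using True by simp
    next
      case y: False
      then show ?thesis
        using pr False
        by (simp add: proportional_def transient_kernel_def sum_distrib_left mult.assoc)
    qed
    finally show "(\<Sum>t. \<Sum>a\<in>UNIV. occupation \<pi> x t y a * ?q y a) = \<dots>" .
  qed
  finally show ?thesis using False by (simp add: add.commute)
qed (simp add: transient_kernel_def)

text \<open>The drift is averaged over the actions. Killing does not alter the integral because
  \<open>V\<close> vanishes on \<open>E\<close>.\<close>

lemma transient_kernel_drift:
  assumes "y \<notin> E"
  shows "(\<integral>\<^sup>+y'. transient_kernel \<phi> y y' * V y' \<partial>count_space UNIV) + 1 \<le> V y"
proof -
  have *: "transient_kernel \<phi> y y' * V y' =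
      (\<Sum>a\<in>UNIV. ennreal (pmf (\<phi> y) a) * (emeasure (p y a) {z. fst z = y'} * V y'))" for y'
    by (auto simp: transient_kernel_def V_absorbed sum_distrib_right mult.assoc split: split_indicator)
  have one: "(\<Sum>a\<in>UNIV. ennreal (pmf (\<phi> y) a)) = 1"
    by (simp add: sum_ennreal sum_pmf_eq_1)
  have "(\<integral>\<^sup>+y'. transient_kernel \<phi> y y' * V y' \<partial>count_space UNIV) + 1 =
      (\<Sum>a\<in>UNIV. ennreal (pmf (\<phi> y) a) * ((\<integral>\<^sup>+z. V (fst z) \<partial>p y a) + 1))"
    unfolding *
    by (simp add: nn_integral_sum nn_integral_cmult nn_integral_state_kernel[OF mdp_axioms]
        distrib_left sum.distrib one)
  also have "\<dots> \<le> (\<Sum>a\<in>UNIV. ennreal (pmf (\<phi> y) a) * V y)"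
    by (intro sum_mono mult_left_mono drift assms) auto
  also have "\<dots> = V y"
    by (simp add: one flip: sum_distrib_right)
  finally show ?thesis .
qed

text \<open>Both totals solve the flow equation of the same \<open>\<phi>\<close>, so
  \<open>flow_le\<close> compares them. The policies play symmetric roles, hence two uses yield
  equality.\<close>

lemma sum_state_law_le_proportional:
  assumes pi: "\<pi> \<in> history_policies" "\<pi>' \<in> history_policies"
    and pr: "proportional \<pi> x \<phi>" "proportional \<pi>' x \<phi>" and y: "y \<notin> E"
  shows "(\<Sum>t. state_law \<pi> x t y) \<le> (\<Sum>t. state_law \<pi>' x t y)"
proof -
  let ?Y = "\<lambda>\<pi> y. (\<Sum>t. state_law \<pi> x t y) * indicator (- E) y"
  have "?Y \<pi> y \<le> ?Y \<pi>' y"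
  proof (rule flow_le[where P="transient_kernel \<phi>" and V=V and \<delta>="\<lambda>y. indicator {x} y * indicator (- E) y"])
    \<comment> \<open>Both \<open>V\<close> and the total mass outside \<open>E\<close> are bounded
      by \<open>B\<close>, which gives the finiteness that \<open>flow_le\<close> asks for.\<close>
    have "(\<integral>\<^sup>+y. ?Y \<pi> y * V y \<partial>count_space UNIV) \<le> (\<integral>\<^sup>+y. ?Y \<pi> y * ennreal B \<partial>count_space UNIV)"
      by (intro nn_integral_mono mult_left_mono V_le) auto
    also have "\<dots> = (\<integral>\<^sup>+y. ?Y \<pi> y \<partial>count_space UNIV) * ennreal B"
      by (rule nn_integral_multc) simp
    also have "\<dots> \<le> ennreal B * ennreal B"
      using order_trans[OF sum_state_law_le[OF pi(1)] V_le] by (rule mult_right_mono) simp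
    also have "\<dots> < \<top>" by (simp add: ennreal_mult_less_top)
    finally show "(\<integral>\<^sup>+y. ?Y \<pi> y * V y \<partial>count_space UNIV) < \<top>" .
  next
    fix y show "?Y \<pi>' y < \<top>"
      using sum_state_law_finite[OF pi(2), of y] by (auto split: split_indicator)
  next
    fix y assume "?Y \<pi> y \<noteq> 0"
    then show "(\<integral>\<^sup>+y'. transient_kernel \<phi> y y' * V y' \<partial>count_space UNIV) + 1 \<le> V y"
      by (intro transient_kernel_drift) (auto split: split_indicator_asm)
  qed (rule eq_refl[OF transient_flow[OF pi(1) pr(1)]],
    rule eq_refl[OF transient_flow[OF pi(2) pr(2), symmetric]])
  then show ?thesis using y by simp
qed

text \<open>The return depends on the policy only through its total occupation outside
  \<open>E\<close>. Since \<open>ennreal\<close> truncates negative reals to zero,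
  \<open>G 1\<close> and \<open>G (- 1)\<close> collect the positive and the negative parts of the
  rewards.\<close>

lemma expected_return_eq:
  fixes x :: 'x
  assumes pi: "\<pi> \<in> history_policies"
  defines "G s \<equiv> \<integral>\<^sup>+y. (\<Sum>a\<in>UNIV. ((\<Sum>t. occupation \<pi> x t y a) * indicator (- E) y) *
    (\<integral>\<^sup>+z. ennreal (s * fst (snd z)) \<partial>p y a)) \<partial>count_space UNIV"
  shows "expected_return p x \<pi> = enn2real (G 1) - enn2real (G (- 1))"
proof -
  let ?T = "trajectory p \<pi> x"
  have r [measurable]: "(\<lambda>\<omega>. reward (\<omega> t)) \<in> borel_measurable ?T" for t
    by (rule measurable_compose[OF measurable_transition_trajectory[OF pi] measurable_reward])
  \<comment> \<open>One identity serves the absolute value and both signs. Rewards earned in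
    \<open>E\<close> vanish almost surely and \<open>g 0 = 0\<close>, so absorbed states contribute
    zero even where their occupation is infinite.\<close>
  have sum: "(\<Sum>t. \<integral>\<^sup>+\<omega>. ennreal (g (reward (\<omega> t))) \<partial>?T) =
      (\<integral>\<^sup>+y. (\<Sum>a\<in>UNIV. ((\<Sum>t. occupation \<pi> x t y a) * indicator (- E) y) *
        (\<integral>\<^sup>+z. ennreal (g (fst (snd z))) \<partial>p y a)) \<partial>count_space UNIV)"
    if g [measurable]: "g \<in> borel_measurable borel" and g0: "g 0 = 0" for g
  proof -
    let ?k = "\<lambda>y a. \<integral>\<^sup>+z. ennreal (g (fst (snd z))) \<partial>p y a"
    have k0: "?k y a = 0" if "y \<in> E" for y a
    proof -
      have "?k y a = (\<integral>\<^sup>+z. 0 \<partial>p y a)"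
        using absorbed[OF that, of a] by (intro nn_integral_cong_AE) (auto simp: g0)
      then show ?thesis by simp
    qed
    have "(\<Sum>t. \<integral>\<^sup>+\<omega>. ennreal (g (reward (\<omega> t))) \<partial>?T) =
        (\<Sum>t. \<integral>\<^sup>+y. (\<Sum>a\<in>UNIV. occupation \<pi> x t y a * ?k y a) \<partial>count_space UNIV)"
      by (subst nn_integral_trajectory_occupation[OF pi, where f="\<lambda>y z. ennreal (g (reward z))"])
         (auto intro!: measurable_compose[OF measurable_reward], simp add: reward_def)
    also have "\<dots> = (\<integral>\<^sup>+y. (\<Sum>t. \<Sum>a\<in>UNIV. occupation \<pi> x t y a * ?k y a) \<partial>count_space UNIV)"
      by (rule nn_integral_suminf[symmetric]) simp
    also have "\<dots> = (\<integral>\<^sup>+y. (\<Sum>a\<in>UNIV. ((\<Sum>t. occupation \<pi> x t y a) * indicator (- E) y) * ?k y a) \<partial>count_space UNIV)"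
      by (intro nn_integral_cong, subst suminf_sum) (auto simp: k0 split: split_indicator)
    finally show ?thesis .
  qed
  \<comment> \<open>The expected absolute rewards sum to at most the product of the bounds on time
    and reward. This justifies exchanging series and expectation below.\<close>
  have abs_finite: "(\<Sum>t. \<integral>\<^sup>+\<omega>. ennreal \<bar>reward (\<omega> t)\<bar> \<partial>?T) < \<top>"
  proof -
    have "(\<Sum>t. \<integral>\<^sup>+\<omega>. ennreal \<bar>reward (\<omega> t)\<bar> \<partial>?T) \<le>
      (\<integral>\<^sup>+y. (\<Sum>a\<in>UNIV. ((\<Sum>t. occupation \<pi> x t y a) * indicator (- E) y) * ennreal C) \<partial>count_space UNIV)"
      by (subst sum[of abs]) (auto intro!: nn_integral_mono sum_mono mult_left_mono reward_le)
    also have "\<dots> = (\<integral>\<^sup>+y. (\<Sum>t. state_law \<pi> x t y) * indicator (- E) y \<partial>count_space UNIV) * ennreal C"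
      by (simp add: sum_occupation[OF pi] nn_integral_multc flip: sum_distrib_right)
    also have "\<dots> \<le> ennreal B * ennreal C"
      using order_trans[OF sum_state_law_le[OF pi] V_le] by (rule mult_right_mono) simp
    also have "\<dots> < \<top>" by (simp add: ennreal_mult_less_top)
    finally show ?thesis .
  qed
  have int: "integrable ?T (\<lambda>\<omega>. reward (\<omega> t))" for t
  proof (rule integrableI_bounded)
    have "(\<integral>\<^sup>+\<omega>. ennreal \<bar>reward (\<omega> t)\<bar> \<partial>?T) \<le> (\<Sum>t. \<integral>\<^sup>+\<omega>. ennreal \<bar>reward (\<omega> t)\<bar> \<partial>?T)"
      using sum_le_suminf[of "\<lambda>t. \<integral>\<^sup>+\<omega>. ennreal \<bar>reward (\<omega> t)\<bar> \<partial>?T" "{t}"] by simp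
    then show "(\<integral>\<^sup>+\<omega>. ennreal (norm (reward (\<omega> t))) \<partial>?T) < \<infinity>"
      using abs_finite by simp
  qed simp
  have "(\<integral>\<^sup>+\<omega>. (\<Sum>t. ennreal \<bar>reward (\<omega> t)\<bar>) \<partial>?T) \<noteq> \<infinity>"
    using abs_finite by (subst nn_integral_suminf) auto
  then have "AE \<omega> in ?T. (\<Sum>t. ennreal \<bar>reward (\<omega> t)\<bar>) \<noteq> \<infinity>"
    by (intro nn_integral_PInf_AE) auto
  then have summable_AE: "AE \<omega> in ?T. summable (\<lambda>t. norm (reward (\<omega> t)))"
    by eventually_elim (auto intro!: summable_suminf_not_top)
  have "(\<Sum>t. ennreal (\<integral>\<omega>. norm (reward (\<omega> t)) \<partial>?T)) \<noteq> \<top>"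
    using abs_finite int by (subst nn_integral_eq_integral[symmetric]) auto
  then have summable_norm: "summable (\<lambda>t. \<integral>\<omega>. norm (reward (\<omega> t)) \<partial>?T)"
    by (intro summable_suminf_not_top) auto
  let ?g = "\<lambda>s t. \<integral>\<^sup>+\<omega>. ennreal (s * reward (\<omega> t)) \<partial>?T"
  have g: "summable (\<lambda>t. enn2real (?g s t))" "(\<Sum>t. enn2real (?g s t)) = enn2real (G s)"
    if s: "s \<in> {1, - 1}" for s
  proof -
    have le: "?g s t \<le> (\<integral>\<^sup>+\<omega>. ennreal \<bar>reward (\<omega> t)\<bar> \<partial>?T)" for t
      using s by (intro nn_integral_mono ennreal_leI) auto
    have "(\<Sum>t. ?g s t) \<le> (\<Sum>t. \<integral>\<^sup>+\<omega>. ennreal \<bar>reward (\<omega> t)\<bar> \<partial>?T)"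
      by (intro suminf_le le) auto
    then have fin: "(\<Sum>t. ?g s t) < \<top>" using abs_finite by (rule le_less_trans)
    have "?g s t \<le> (\<Sum>t. ?g s t)" for t
      using sum_le_suminf[of "?g s" "{t}"] by simp
    then have fin_t: "?g s t < \<top>" for t
      using fin le_less_trans by blast
    then have eq: "(\<Sum>t. ennreal (enn2real (?g s t))) = (\<Sum>t. ?g s t)"
      by (intro suminf_cong) simp
    then show sm: "summable (\<lambda>t. enn2real (?g s t))"
      using fin by (intro summable_suminf_not_top) auto
    have "(\<Sum>t. ?g s t) = G s"
      unfolding G_def using sum[of "\<lambda>r. s * r"] by simp
    then show "(\<Sum>t. enn2real (?g s t)) = enn2real (G s)"
      using suminf_ennreal2[OF _ sm] eq by (simp add: suminf_nonneg[OF sm])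
  qed
  have "expected_return p x \<pi> = (\<Sum>t. \<integral>\<omega>. reward (\<omega> t) \<partial>?T)"
    unfolding expected_return_def by (rule integral_suminf[OF int summable_AE summable_norm])
  also have "\<dots> = (\<Sum>t. enn2real (?g 1 t) - enn2real (?g (- 1) t))"
    by (simp add: real_lebesgue_integral_def[OF int])
  also have "\<dots> = enn2real (G 1) - enn2real (G (- 1))"
    using g[of 1] g[of "- 1"] by (subst suminf_diff[symmetric]) auto
  finally show ?thesis .
qed

theorem stationary_adequate:
  assumes pi: "\<pi> \<in> history_policies" and feas: "feasible p x \<pi>"
  obtains \<pi>' where "\<pi>' \<in> stationary_policies" "feasible p x \<pi>'"
    "expected_return p x \<pi>' = expected_return p x \<pi>"
proof -
  \<comment> \<open>The first conjunct fixes the action ratios outside \<open>E\<close>. The second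
    keeps the support of \<open>q\<close> within the actions that occur under \<open>\<pi>\<close>,
    as feasibility requires. In a state never visited both hold for every \<open>q\<close>.\<close>
  have "\<exists>q. (y \<notin> E \<longrightarrow> (\<forall>a. (\<Sum>t. occupation \<pi> x t y a) = (\<Sum>t. state_law \<pi> x t y) * ennreal (pmf q a))) \<and>
      ((\<exists>t. state_law \<pi> x t y \<noteq> 0) \<longrightarrow> (\<forall>a\<in>set_pmf q. \<exists>t. occupation \<pi> x t y a \<noteq> 0))" for y
  proof (cases "\<forall>t. state_law \<pi> x t y = 0")
    case True
    then have "occupation \<pi> x t y a = 0" for t a
      using state_law_eq_sum[OF pi, of x t y] by simp
    with True show ?thesis by auto
  next
    case False
    then obtain t a where ta: "occupation \<pi> x t y a \<noteq> 0"
      using state_law_eq_sum[OF pi, of x _ y] by auto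
    show ?thesis
    proof (cases "y \<in> E")
      case True
      with ta show ?thesis by (intro exI[of _ "return_pmf a"]) auto
    next
      case y: False
      have "(\<Sum>t. state_law \<pi> x t y) \<noteq> 0"
        using False by (subst suminf_eq_zero_iff) auto
      then obtain q where q: "\<And>a. (\<Sum>t. occupation \<pi> x t y a) = (\<Sum>t. state_law \<pi> x t y) * ennreal (pmf q a)"
        using ex_pmf_proportional[of "\<lambda>a. \<Sum>t. occupation \<pi> x t y a"] sum_state_law_finite[OF pi y]
        unfolding sum_occupation[OF pi] by metis
      have "\<exists>t. occupation \<pi> x t y a \<noteq> 0" if "a \<in> set_pmf q" for a
      proof (rule ccontr)
        assume "\<not> ?thesis"
        then have "(\<Sum>t. occupation \<pi> x t y a) = 0" by simp
        with q[of a] \<open>(\<Sum>t. state_law \<pi> x t y) \<noteq> 0\<close> that show False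
          by (simp add: set_pmf_iff)
      qed
      with q show ?thesis by auto
    qed
  qed
  then obtain \<phi> where pr: "proportional \<pi> x \<phi>"
    and supp: "\<And>y t a. state_law \<pi> x t y \<noteq> 0 \<Longrightarrow> a \<in> set_pmf (\<phi> y) \<Longrightarrow> \<exists>t. occupation \<pi> x t y a \<noteq> 0"
    unfolding proportional_def by metis
  define \<pi>' :: "('x, 'a) policy" where "\<pi>' = (\<lambda>t h. \<phi> (state_at t h))"
  have st: "\<pi>' \<in> stationary_policies" by (auto simp: stationary_policies_def \<pi>'_def)
  then have pi': "\<pi>' \<in> history_policies" using stationary_policies_subset by blast
  note occ' = occupation_stationary[OF pi' \<pi>'_def]
  have pr': "proportional \<pi>' x \<phi>"
    by (simp add: proportional_def occ')
  have supp_occ: "\<exists>t. occupation \<pi> x t y a \<noteq> 0"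
    if "\<exists>t. state_law \<pi> x t y \<noteq> 0" "occupation \<pi>' x t' y a \<noteq> 0" for y a t'
    using that supp by (auto simp: occ' set_pmf_iff)
  \<comment> \<open>Supports are compared over all times together, because the two policies may
    reach a state at different times. Each induction step carries a positive term of the forward
    equation from \<open>\<pi>'\<close> over to \<open>\<pi>\<close>.\<close>
  have supp_state: "\<exists>t. state_law \<pi> x t y \<noteq> 0" if "state_law \<pi>' x t' y \<noteq> 0" for t' y
    using that
  proof (induction t' arbitrary: y)
    case 0
    then have "state_law \<pi> x 0 y \<noteq> 0" by (simp add: state_law_0[OF pi] state_law_0[OF pi'])
    then show ?case ..
  next
    case (Suc t')
    then obtain y0 a where *: "occupation \<pi>' x t' y0 a \<noteq> 0" "emeasure (p y0 a) {z. fst z = y} \<noteq> 0"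
      by (auto simp: state_law_Suc[OF pi'] nn_integral_0_iff_AE AE_count_space)
    then have "state_law \<pi>' x t' y0 \<noteq> 0" by (auto simp: occ')
    from supp_occ[OF Suc.IH[OF this] *(1)] obtain t where "occupation \<pi> x t y0 a \<noteq> 0" ..
    with *(2) have "state_law \<pi> x (Suc t) y \<noteq> 0"
      by (auto simp: state_law_Suc[OF pi] nn_integral_0_iff_AE AE_count_space)
    then show ?case ..
  qed
  have "feasible p x \<pi>'"
    unfolding feasible_iff[OF pi']
  proof (intro allI disjCI)
    fix t y a assume "emeasure (p y a) {z. snd (snd z)} \<noteq> 0"
    then have "\<not> (\<exists>t. occupation \<pi> x t y a \<noteq> 0)" using feas unfolding feasible_iff[OF pi] by blast
    then show "occupation \<pi>' x t y a = 0"
      using supp_occ[of y t a] supp_state[of t y] by (auto simp: occ')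
  qed
  \<comment> \<open>The comparison in both directions gives equal state totals, and proportionality
    passes this on to state-action pairs.\<close>
  moreover have "(\<Sum>t. occupation \<pi>' x t y a) = (\<Sum>t. occupation \<pi> x t y a)" if "y \<notin> E" for y a
    using sum_state_law_le_proportional[OF pi pi' pr pr' that]
      sum_state_law_le_proportional[OF pi' pi pr' pr that] pr pr' that
    by (simp add: proportional_def)
  then have "(\<Sum>t. occupation \<pi>' x t y a) * indicator (- E) y =
      (\<Sum>t. occupation \<pi> x t y a) * indicator (- E) y" for y a
    by (auto split: split_indicator)
  then have "expected_return p x \<pi>' = expected_return p x \<pi>"
    by (simp only: expected_return_eq[OF pi] expected_return_eq[OF pi'])
  ultimately show ?thesis using that st by blast
qed

end


subsection \<open>A Lyapunov function from almost sure termination\<close>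

context cmdp
begin

text \<open>Following \<open>\<alpha>\<close> forever from a state of \<open>T\<close> keeps all
  marginal laws on \<open>T\<close>, by induction on time. As there are countably many times,
  \<open>s_end\<close> is almost surely never visited, which contradicts
  \<open>terminating\<close>.\<close>

lemma no_trap:
  assumes avoid: "s_end \<notin> T" and stay: "\<And>s. s \<in> T \<Longrightarrow> AE z in p s (\<alpha> s). fst z \<in> T"
  shows "T = {}"
proof (rule ccontr)
  assume "T \<noteq> {}"
  then obtain s where s: "s \<in> T" by blast
  define \<phi> where "\<phi> s = return_pmf (\<alpha> s)" for s
  define \<pi> :: "('s, 'a) policy" where "\<pi> = (\<lambda>t h. \<phi> (state_at t h))"
  have "\<pi> \<in> stationary_policies" by (auto simp: stationary_policies_def \<pi>_def)
  then have pi: "\<pi> \<in> history_policies" using stationary_policies_subset by blast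
  have law: "state_law \<pi> s t y = 0" if "y \<notin> T" for t y
    using that
  proof (induction t arbitrary: y)
    case 0
    with s show ?case by (auto simp: state_law_0[OF pi] indicator_def)
  next
    case (Suc t)
    have "occupation \<pi> s t x a * emeasure (p x a) {z. fst z = y} = 0" for x a
    proof (cases "x \<in> T \<and> a = \<alpha> x")
      case True
      then have "AE z in p x a. fst z \<noteq> y" using stay[of x] Suc.prems by auto
      then show ?thesis
        by (subst (asm) AE_iff_measurable[OF sets_kernel_fst[of y x a]]) auto
    next
      case False
      then show ?thesis
        using Suc.IH[of x] by (auto simp: occupation_stationary[OF pi \<pi>_def] \<phi>_def indicator_def)
    qed
    then show ?case by (simp add: state_law_Suc[OF pi] nn_integral_0_iff_AE AE_count_space)
  qed
  note [measurable] = measurable_state_at_trajectory[OF pi]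
  have "AE \<omega> in trajectory p \<pi> s. state_at t (s, \<omega>) \<noteq> s_end" for t
    using law[OF avoid, of t] unfolding state_law_def
    by (subst (asm) nn_integral_0_iff_AE) (auto simp: indicator_def split: if_splits)
  then have "AE \<omega> in trajectory p \<pi> s. \<not> (\<exists>t. state_at t (s, \<omega>) = s_end)"
    by (simp add: AE_all_countable)
  with terminating[OF pi, of s] show False
    by (rule prob_space.AE_contr[OF prob_space_trajectory[OF pi]])
qed

text \<open>The attractor of \<open>s_end\<close>: from \<open>level n\<close> it is reached within
  \<open>n\<close> steps with positive probability, whatever the actions are.\<close>

primrec level :: "nat \<Rightarrow> 's set" where
  "level 0 = {s_end}"
| "level (Suc n) = level n \<union> {s. \<forall>a. \<exists>s'\<in>level n. measure (p s a) {z. fst z = s'} > 0}"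

lemma level_mono: "m \<le> n \<Longrightarrow> level m \<subseteq> level n"
  by (rule lift_Suc_mono_le[of level]) auto

text \<open>The states outside all levels would form a trap, so there are none; finitely many states
  then share a common level.\<close>

lemma ex_level_UNIV: "\<exists>N. level N = UNIV"
proof -
  let ?L = "\<Union>n. level n"
  \<comment> \<open>If every action led into some level with positive probability, one level would
    serve the finitely many actions, and \<open>s\<close> would lie in the next one. So some action
    avoids all levels.\<close>
  have "\<exists>a. \<forall>s'\<in>?L. measure (p s a) {z. fst z = s'} = 0" if "s \<notin> ?L" for s
  proof (rule ccontr)
    assume "\<not> ?thesis"
    then have "\<forall>a. \<exists>n. \<exists>s'\<in>level n. measure (p s a) {z. fst z = s'} > 0"
      by (auto simp: zero_less_measure_iff)
    then obtain n where n: "\<And>a. \<exists>s'\<in>level (n a). measure (p s a) {z. fst z = s'} > 0" by metis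
    have "level (n a) \<subseteq> level (Max (range n))" for a
      by (intro level_mono Max_ge) auto
    with n have "\<exists>s'\<in>level (Max (range n)). measure (p s a) {z. fst z = s'} > 0" for a
      by (meson subsetD)
    then have "s \<in> level (Suc (Max (range n)))" by simp
    with that show False by blast
  qed
  then obtain \<alpha> where \<alpha>: "\<And>s s'. s \<notin> ?L \<Longrightarrow> s' \<in> ?L \<Longrightarrow> measure (p s (\<alpha> s)) {z. fst z = s'} = 0"
    by metis
  have "- ?L = {}"
  proof (rule no_trap)
    have "s_end \<in> level 0" by simp
    then show "s_end \<notin> - ?L" by blast
    fix s assume s: "s \<in> - ?L"
    interpret prob_space "p s (\<alpha> s)" by (rule prob_space_kernel)
    have "AE z in p s (\<alpha> s). fst z \<noteq> s'" if "s' \<in> ?L" for s'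
      using \<alpha>[of s s'] s that
      by (subst AE_iff_measurable[OF sets_kernel_fst[of s' s "\<alpha> s"]]) (auto simp: emeasure_eq_measure)
    then have "AE z in p s (\<alpha> s). \<forall>s'\<in>?L. fst z \<noteq> s'"
      by (intro AE_finite_allI) auto
    then show "AE z in p s (\<alpha> s). fst z \<in> - ?L" by eventually_elim auto
  qed
  then have "\<exists>n. s \<in> level n" for s by blast
  then obtain n where n: "\<And>s. s \<in> level (n s)" by metis
  have "s \<in> level (Max (range n))" for s
    using n[of s] level_mono[of "n s" "Max (range n)"] by auto
  then show ?thesis by blast
qed

text \<open>
  With \<open>\<epsilon>\<close> the least positive transition probability, \<open>\<theta> = \<epsilon> / 2\<close> and \<open>l\<close> the level, the expectation of
  \<open>\<theta> ^ l\<close> after one step is at least \<open>\<epsilon> \<theta> ^ (l - 1) = 2 \<theta> ^ l\<close>. Hence \<open>K (1 - \<theta> ^ l)\<close> drops by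
  \<open>K \<theta> ^ l \<ge> 1\<close> in expectation.
\<close>

lemma ex_Lyapunov:
  obtains V :: "'s \<Rightarrow> ennreal" and B :: real where "V s_end = 0" "\<And>s. V s \<le> ennreal B"
    "\<And>s a. s \<noteq> s_end \<Longrightarrow> (\<integral>\<^sup>+z. V (fst z) \<partial>p s a) + 1 \<le> V s"
proof -
  obtain N where N: "level N = UNIV" using ex_level_UNIV by blast
  define l where "l s = (LEAST n. s \<in> level n)" for s
  have l: "s \<in> level (l s)" "l s \<le> N" for s
    unfolding l_def using N by (auto intro: LeastI[of _ N] Least_le)
  have l_le: "l s \<le> n" if "s \<in> level n" for s n
    unfolding l_def using that by (rule Least_le)
  \<comment> \<open>Finitely many states and actions make \<open>Q\<close> finite; the inserted 1
    makes it nonempty and gives \<open>Min Q \<le> 1\<close>.\<close>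
  define Q where "Q = insert 1 ({q. \<exists>s a s'. q = measure (p s a) {z. fst z = s'}} \<inter> {0<..})"
  have "finite {q. \<exists>s a s'. q = measure (p s a) {z. fst z = s'}}"
    by (rule finite_subset[of _ "range (\<lambda>(s, a, s'). measure (p s a) {z. fst z = s'})"])
       (auto simp: image_iff, blast)
  then have finQ: "finite Q" by (auto simp: Q_def)
  define \<theta> where "\<theta> = Min Q / 2"
  have "Min Q \<in> Q" using finQ by (intro Min_in) (auto simp: Q_def)
  then have \<theta>0: "\<theta> > 0" by (auto simp: \<theta>_def Q_def)
  have "Min Q \<le> 1" by (rule Min_le[OF finQ]) (simp add: Q_def)
  then have \<theta>1: "\<theta> \<le> 1" by (simp add: \<theta>_def)
  have \<theta>_le: "2 * \<theta> \<le> measure (p s a) {z. fst z = s'}" if "measure (p s a) {z. fst z = s'} > 0" for s a s'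
    using finQ that by (auto simp: \<theta>_def Q_def intro!: Min_le)
  \<comment> \<open>Chosen so that \<open>K * \<theta> ^ l s\<close> is at least 1 for every level
    up to \<open>N\<close>.\<close>
  define K where "K = 1 / \<theta> ^ N"
  have K0: "K \<ge> 0" using \<theta>0 by (simp add: K_def)
  define v where "v s = K * (1 - \<theta> ^ l s)" for s
  have pow: "0 \<le> \<theta> ^ n" "\<theta> ^ n \<le> 1" for n
    using \<theta>0 \<theta>1 by (auto intro: power_le_one)
  have v0: "0 \<le> v s" and vK: "v s \<le> K" for s
    using K0 pow[of "l s"] by (auto simp: v_def intro: mult_left_le)
  have drift: "(\<integral>z. v (fst z) \<partial>p s a) + 1 \<le> v s" if s: "s \<noteq> s_end" for s a
  proof -
    interpret prob_space "p s a" by (rule prob_space_kernel)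
    note [measurable] = measurable_fst_kernel[of s a]
    obtain m where m: "l s = Suc m"
      using s l(1)[of s] by (cases "l s") auto
    \<comment> \<open>Since \<open>Suc m\<close> is the least level containing \<open>s\<close>, the
      defining clause of that level supplies a successor \<open>s'\<close> for the action
      \<open>a\<close>.\<close>
    have "s \<notin> level m" using l_le[of s m] m by auto
    with l(1)[of s] m obtain s' where s': "s' \<in> level m" "measure (p s a) {z. fst z = s'} > 0" by auto
    have int: "integrable (p s a) (\<lambda>z. \<theta> ^ l (fst z))"
      using pow by (intro integrable_const_bound[of _ 1] AE_I2) auto
    have "2 * \<theta> ^ l s = 2 * \<theta> * \<theta> ^ m" by (simp add: m)
    also have "\<dots> \<le> measure (p s a) {z. fst z = s'} * \<theta> ^ l s'"
      using \<theta>_le[OF s'(2)] l_le[OF s'(1)] \<theta>0 \<theta>1 by (intro mult_mono power_decreasing) auto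
    also have "\<dots> = (\<integral>z. \<theta> ^ l s' * indicator {z. fst z = s'} z \<partial>p s a)"
      using sets_kernel_fst[of s' s a] by simp
    also have "\<dots> \<le> (\<integral>z. \<theta> ^ l (fst z) \<partial>p s a)"
      using sets_kernel_fst[of s' s a] pow int
      by (intro integral_mono) (auto simp: emeasure_eq_measure split: split_indicator)
    finally have *: "2 * \<theta> ^ l s \<le> (\<integral>z. \<theta> ^ l (fst z) \<partial>p s a)" .
    have "1 \<le> K * \<theta> ^ l s"
      using \<theta>0 \<theta>1 l(2)[of s] by (simp add: K_def field_simps power_decreasing)
    moreover have "(\<integral>z. v (fst z) \<partial>p s a) = K * (1 - (\<integral>z. \<theta> ^ l (fst z) \<partial>p s a))"
      unfolding v_def using int prob_space by (simp add: Bochner_Integration.integral_diff)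
    moreover have "K * (2 * \<theta> ^ l s) \<le> K * (\<integral>z. \<theta> ^ l (fst z) \<partial>p s a)"
      using * K0 by (rule mult_left_mono)
    ultimately show ?thesis by (simp add: v_def algebra_simps)
  qed
  show ?thesis
  proof (rule that[of "\<lambda>s. ennreal (v s)" K])
    have "l s_end = 0" using l_le[of s_end 0] by simp
    then show "ennreal (v s_end) = 0" by (simp add: v_def)
    show "ennreal (v s) \<le> ennreal K" for s by (rule ennreal_leI[OF vK])
    fix s a assume "s \<noteq> s_end"
    interpret prob_space "p s a" by (rule prob_space_kernel)
    note [measurable] = measurable_fst_kernel[of s a]
    have "(\<integral>\<^sup>+z. ennreal (v (fst z)) \<partial>p s a) = ennreal (\<integral>z. v (fst z) \<partial>p s a)"
      using v0 vK by (intro nn_integral_eq_integral integrable_const_bound[of _ K] AE_I2) auto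
    then have "(\<integral>\<^sup>+z. ennreal (v (fst z)) \<partial>p s a) + 1 = ennreal ((\<integral>z. v (fst z) \<partial>p s a) + 1)"
      using v0 by (simp add: integral_nonneg_AE flip: ennreal_1)
    then show "(\<integral>\<^sup>+z. ennreal (v (fst z)) \<partial>p s a) + 1 \<le> ennreal (v s)"
      using drift[OF \<open>s \<noteq> s_end\<close>, of a] by (simp add: ennreal_leI)
  qed
qed

section \<open>Transfer to the process augmented by the budget\<close>

lemma measurable_discrete_kernel:
  "(\<lambda>z. g (fst z) (snd (snd z))) \<in> p s a \<rightarrow>\<^sub>M count_space UNIV"
  by (rule measurable_compose_countable'[where I=UNIV and g=fst, OF _ measurable_fst_kernel],
      rule measurable_compose_countable'[where I=UNIV and g="\<lambda>z. snd (snd z)"])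
     (simp_all add: measurable_cong_sets[OF sets_kernel refl] outcome_space_def)

lemma augment_map_measurable:
  "(\<lambda>(s', r, d). ((s', k - of_bool d), r, k - of_bool d < 0)) \<in> p s a \<rightarrow>\<^sub>M outcome_space"
proof -
  have "(\<lambda>z. fst (snd z)) \<in> p s a \<rightarrow>\<^sub>M borel"
    unfolding measurable_cong_sets[OF sets_kernel refl] outcome_space_def by simp
  then show ?thesis
    unfolding case_prod_beta
    by (subst outcome_space_def)
       (intro measurable_Pair measurable_discrete_kernel[of "\<lambda>x d. (x, k - of_bool d)"] measurable_discrete_kernel[of "\<lambda>x d. k - of_bool d < 0"])
qed

text \<open>Augmentation leaves the joint law of the next original state and the reward unchanged,
  so a Lyapunov function of the original state works for every budget.\<close>

lemma absorbing_mdp_augment: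
  obtains V B C where "absorbing_mdp (augment p) {x. fst x = s_end} V B C"
proof -
  obtain V0 :: "'s \<Rightarrow> ennreal" and B where V0: "V0 s_end = 0" "\<And>s. V0 s \<le> ennreal B"
    "\<And>s a. s \<noteq> s_end \<Longrightarrow> (\<integral>\<^sup>+z. V0 (fst z) \<partial>p s a) + 1 \<le> V0 s"
    using ex_Lyapunov by blast
  \<comment> \<open>With finitely many state-action pairs, the sum of all mean absolute rewards
    bounds each of them.\<close>
  define C where "C = (\<Sum>s\<in>UNIV. \<Sum>a\<in>UNIV. \<integral>z. \<bar>fst (snd z)\<bar> \<partial>p s a)"
  have int: "integrable (p s a) (\<lambda>z. \<bar>fst (snd z)\<bar>)" for s a
    using integrable_reward[of s a] by (intro integrable_abs) (simp add: split_beta')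
  have reward: "(\<integral>\<^sup>+z. ennreal \<bar>fst (snd z)\<bar> \<partial>p s a) \<le> ennreal C" for s a
  proof -
    let ?c = "\<lambda>s a. \<integral>z. \<bar>fst (snd z)\<bar> \<partial>p s a"
    have "?c s a \<le> (\<Sum>a\<in>UNIV. ?c s a)"
      by (intro member_le_sum) (auto intro: integral_nonneg_AE)
    also have "\<dots> \<le> C"
      unfolding C_def by (intro member_le_sum sum_nonneg) (auto intro: integral_nonneg_AE)
    finally show ?thesis
      by (subst nn_integral_eq_integral[OF int]) (auto intro: ennreal_leI)
  qed
  have fst': "fst \<in> outcome_space \<rightarrow>\<^sub>M count_space (UNIV :: ('s \<times> int) set)"
    and r': "(\<lambda>z. fst (snd z)) \<in> borel_measurable (outcome_space :: ('s \<times> int) outcome measure)"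
    by (simp_all add: outcome_space_def)
  have V': "(\<lambda>z. V0 (fst (fst z))) \<in> borel_measurable (outcome_space :: ('s \<times> int) outcome measure)"
    by (rule measurable_compose[OF fst']) simp
  have "absorbing_mdp (augment p) {x. fst x = s_end} (\<lambda>x. V0 (fst x)) B C"
  proof (intro absorbing_mdp.intro mdp_augment absorbing_mdp_axioms.intro)
    show "mdp p" by (rule mdp_axioms)
    fix x :: "'s \<times> int" and a
    obtain s k where x: "x = (s, k)" by (cases x)
    note augment_x = augment_def x prod.case
    note map_meas = augment_map_measurable[of k s a]
    show "V0 (fst x) \<le> ennreal B" by (rule V0)
    show "(\<integral>\<^sup>+z. ennreal \<bar>fst (snd z)\<bar> \<partial>augment p x a) \<le> ennreal C"
      unfolding augment_x
      by (subst nn_integral_distr[OF map_meas]) (use r' reward[of s a] in \<open>auto simp: case_prod_beta\<close>)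
    show "(\<integral>\<^sup>+z. V0 (fst (fst z)) \<partial>augment p x a) + 1 \<le> V0 (fst x)" if "x \<notin> {x. fst x = s_end}"
      unfolding augment_x
      by (subst nn_integral_distr[OF map_meas]) (use that V' V0(3)[of s a] in \<open>auto simp: case_prod_beta x\<close>)
    show "V0 (fst x) = 0" if "x \<in> {x. fst x = s_end}"
      using that V0(1) by simp
    show "AE z in augment p x a. fst z \<in> {x. fst x = s_end} \<and> fst (snd z) = 0"
      if "x \<in> {x. fst x = s_end}"
    proof -
      have "{z \<in> space outcome_space. fst z \<in> {x. fst x = s_end} \<and> fst (snd z) = 0}
          \<in> sets (outcome_space :: ('s \<times> int) outcome measure)"
        using sets.Int[OF measurable_sets[OF fst', of "{x. fst x = s_end}"] measurable_sets[OF r', of "{0}"]]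
        by (simp add: vimage_def Int_def)
      then show ?thesis
        unfolding augment_x
        using absorbing[of a] that by (subst AE_distr_iff[OF map_meas]) (auto simp: case_prod_beta x)
    qed
  qed
  then show ?thesis by (rule that)
qed

end

theorem lemma6:
  fixes p :: "('s::finite, 'a::finite) kernel"
    and s_end s :: 's
    and \<Delta> :: nat
  assumes "cmdp p s_end"
  shows "\<forall>\<pi>\<^sub>h \<in> history_policies. feasible (augment p) (s, int \<Delta>) \<pi>\<^sub>h \<longrightarrow>
    (\<exists>\<pi> \<in> stationary_policies. feasible (augment p) (s, int \<Delta>) \<pi> \<and>
      expected_return (augment p) (s, int \<Delta>) \<pi> = expected_return (augment p) (s, int \<Delta>) \<pi>\<^sub>h)"
proof (intro ballI impI)
  fix \<pi>\<^sub>h :: "('s \<times> int, 'a) policy"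
  assume pi: "\<pi>\<^sub>h \<in> history_policies" and feas: "feasible (augment p) (s, int \<Delta>) \<pi>\<^sub>h"
  obtain V B C where "absorbing_mdp (augment p) {x. fst x = s_end} V B C"
    by (rule cmdp.absorbing_mdp_augment[OF assms])
  from absorbing_mdp.stationary_adequate[OF this pi feas]
  show "\<exists>\<pi> \<in> stationary_policies. feasible (augment p) (s, int \<Delta>) \<pi> \<and>
      expected_return (augment p) (s, int \<Delta>) \<pi> = expected_return (augment p) (s, int \<Delta>) \<pi>\<^sub>h"
    by blast
qed

end
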